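(* Let $\mu$ be a finite positive Borel measure on $[0,1)$ and let $\mu_n=\int_{[0,1)}t^n\,d\mu(t)$ for $n\in\mathbb{N}$. Then the following conditions are equivalent. (i) The Hankel type operator $\mathcal{H}_\mu$ is bounded on the Dirichlet space $\mathcal{D}$. (ii) $\sup_{t\in[0,1)}\|\mathcal{H}_\mu(k_t)\|_{\mathcal{D}}<\infty$, where $k_t$ is the normalized reproducing kernel of $\mathcal{D}$ at $t\in[0,1)$. (iii) $\displaystyle\sum_{n=m}^\infty n\mu_n^2=O\left(\frac{1}{\log(m+2)}\right)$, i.e. there is a constant $C$ with $\sum_{n=m}^\infty n\mu_n^2\le \frac{C}{\log(m+2)}$ for all $m\in\mathbb{N}$.
   Context: $\mathbb{N}$ is the set of nonnegative integers, $\mathbb{D}$ is the open unit disk, $H(\mathbb{D})$ is the space of analytic functions on $\mathbb{D}$, and $dA=\pi^{-1}dx\,dy$ is normalized Lebesgue measure on $\mathbb{D}$. The Dirichlet space $\mathcal{D}$ is the Hilbert space of $f\in H(\mathbb{D})$ with $\|f\|_{\mathcal{D}}^2=|f(0)|^2+\int_{\mathbb{D}}|f'(z)|^2dA(z)<\infty$. Its reproducing kernel at $w\in\mathbb{D}$ is $K_w(z)=1+\log\frac{1}{1-z\overline{w}}$, and the normalized reproducing kernel is $k_w(z)=K_w(z)/\sqrt{K_w(w)}$. For $f(z)=\sum_{k\ge0}a_kz^k\in H(\mathbb{D})$, $\mathcal{H}_\mu(f)(z)=\sum_{n=0}^\infty\left(\sum_{k=0}^\infty\mu_{n+k}a_k\right)z^n$,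 whenever the right-hand side makes sense and defines an analytic function in $\mathbb{D}$. It is bounded on $\mathcal{D}$ if $\mathcal{H}_\mu(f)$ is well defined in $H(\mathbb{D})$ for every $f\in\mathcal{D}$ and there is a constant $C>0$ with $\|\mathcal{H}_\mu(f)\|_{\mathcal{D}}\le C\|f\|_{\mathcal{D}}$ for all $f\in\mathcal{D}$. The norm $\|\cdot\|_{\mathcal{D}}$ is understood to be $+\infty$ for a function not in $\mathcal{D}$. *)

theory Defs
  imports "HOL-Complex_Analysis.Complex_Analysis"
begin

(* Squared Dirichlet norm of f, possibly infinite; the factor 1 / pi turns planar
   Lebesgue measure into the normalized area measure dA. *)
definition dirichlet_normsq :: "(complex \<Rightarrow> complex) \<Rightarrow> ennreal" where
  "dirichlet_normsq f =
     ennreal ((cmod (f 0))\<^sup>2) +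
     ennreal (1 / pi) *
       (\<integral>\<^sup>+ z. ennreal ((cmod (deriv f z))\<^sup>2) * indicator (ball 0 1) z \<partial>lborel)"

(* Functions are total on the complex plane, but only their values on the open unit
   disk matter for any notion below. *)
definition dirichlet_space :: "(complex \<Rightarrow> complex) set" where
  "dirichlet_space = {f. f holomorphic_on ball 0 1 \<and> dirichlet_normsq f < \<infinity>}"

definition dirichlet_norm :: "(complex \<Rightarrow> complex) \<Rightarrow> ennreal" where
  "dirichlet_norm f =
     (if f \<in> dirichlet_space then ennreal (sqrt (enn2real (dirichlet_normsq f))) else \<infinity>)"

definition dirichlet_kernel :: "complex \<Rightarrow> complex \<Rightarrow> complex" where
  "dirichlet_kernel w z = 1 + Ln (1 / (1 - z * cnj w))"

(* For w in the unit disk, dirichlet_kernel w w is a real number >= 1, so csqrt is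
   the positive square root. *)
definition normalized_dirichlet_kernel :: "complex \<Rightarrow> complex \<Rightarrow> complex" where
  "normalized_dirichlet_kernel w z = dirichlet_kernel w z / csqrt (dirichlet_kernel w w)"

definition moment :: "real measure \<Rightarrow> nat \<Rightarrow> real" where
  "moment \<mu> n = (\<integral>t. t ^ n \<partial>\<mu>)"

definition taylor_coeff :: "(complex \<Rightarrow> complex) \<Rightarrow> nat \<Rightarrow> complex" where
  "taylor_coeff f k = (deriv ^^ k) f 0 / fact k"

definition hankel_coeff :: "real measure \<Rightarrow> (complex \<Rightarrow> complex) \<Rightarrow> nat \<Rightarrow> complex" where
  "hankel_coeff \<mu> f n = (\<Sum>k. of_real (moment \<mu> (n + k)) * taylor_coeff f k)"

definition hankel_op :: "real measure \<Rightarrow> (complex \<Rightarrow> complex) \<Rightarrow> complex \<Rightarrow> complex" where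
  "hankel_op \<mu> f z = (\<Sum>n. hankel_coeff \<mu> f n * z ^ n)"

(* All series defining hankel_op converge (in the usual, possibly conditional, sense)
   and the resulting function is analytic on the disk. *)
definition hankel_well_defined :: "real measure \<Rightarrow> (complex \<Rightarrow> complex) \<Rightarrow> bool" where
  "hankel_well_defined \<mu> f \<longleftrightarrow>
     (\<forall>n. summable (\<lambda>k. of_real (moment \<mu> (n + k)) * taylor_coeff f k)) \<and>
     (\<forall>z\<in>ball 0 1. summable (\<lambda>n. hankel_coeff \<mu> f n * z ^ n)) \<and>
     hankel_op \<mu> f holomorphic_on ball 0 1"

definition hankel_bounded_on_dirichlet :: "real measure \<Rightarrow> bool" where
  "hankel_bounded_on_dirichlet \<mu> \<longleftrightarrow>
     (\<forall>f\<in>dirichlet_space. hankel_well_defined \<mu> f) \<and>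
     (\<exists>C::real. C > 0 \<and>
        (\<forall>f\<in>dirichlet_space. dirichlet_norm (hankel_op \<mu> f) \<le> ennreal C * dirichlet_norm f))"

end

(* For f = sum a_k z^k in the disc, the rotation invariance of area makes monomials orthogonal, so
   the squared Dirichlet norm is |a_0|^2 + sum k |a_k|^2, which up to a factor 2 is
   sum (k+1) |a_k|^2. Everything then becomes a question about the Hankel matrix (mu_(n+k)).

   (iii) => (i): split sum_k mu_(n+k) a_k at k = n and use that moments decrease. For k <= n the
   bound mu_(n+k) <= mu_n leads to a weighted Hardy inequality with weight (n+1) mu_n^2, whose
   Muckenhoupt condition is exactly (iii); for k > n the bound mu_(n+k) <= mu_k = O(1/(k+1)) leads
   to the dual Hardy inequality.

   (ii) => (iii): for t = (m+1)/(m+2) and n >= m, the n-th coefficient of the image of k_t is at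
   least mu_(2n) times the sum of the first m+1 coefficients of k_t, which is of order
   sqrt (log (m+2)). *)
theory Submission
  imports Defs
begin

subsection \<open>Area integrals of power series\<close>

text \<open>For the weights \<open>(n + 1) * (moment \<mu> n)^2\<close> and \<open>k + 1\<close>,
  the Muckenhoupt condition asks that the product of the tail sum of the first from \<open>m\<close>
  on and of the sum of \<open>1 / (k + 1)\<close> over \<open>k <= m\<close> stay bounded in
  \<open>m\<close>. The second factor grows like \<open>ln (m + 2)\<close>, and this is where the
  logarithm in (iii) comes from. Boundedness cannot be tested on the operator directly, because even
  the rows of the matrix are not known to converge in advance. All estimates are therefore made for
  square sections of the matrix and for absolute values of coefficients, with a constant independent
  of the section. Since the moments are nonnegative, absolute values majorize, and the limit then
  gives convergence and the norm bound together. (i) implies (ii) because the normalized kernels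
  have uniformly bounded norm. The choice \<open>t = 1 - 1 / (m + 2)\<close> keeps
  \<open>t ^ k\<close> bounded below for \<open>k <= m\<close>, while \<open>K_t(t)\<close> is only
  of order \<open>ln (m + 2)\<close>. It controls moments of even index only; monotonicity fills in
  the odd ones.\<close>

lemma nn_integral_lborel_translate:
  fixes f :: "'a::euclidean_space \<Rightarrow> ennreal"
  assumes [measurable]: "f \<in> borel_measurable borel"
  shows "(\<integral>\<^sup>+ x. f (c + x) \<partial>lborel) = (\<integral>\<^sup>+ x. f x \<partial>lborel)"
  by (subst lborel_distr_plus[of c, symmetric]) (subst nn_integral_distr; simp)

text \<open>A convolution argument that needs no Jacobian. Averaging \<open>f (c * x + y)\<close>
  over \<open>y\<close> in the unit ball changes nothing, by translation of \<open>x\<close> by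
  \<open>y / c\<close>. After Fubini and the translation \<open>y\<close> to
  \<open>y - c * x\<close>, the inner integral over \<open>x\<close> is the area of a unit ball
  about \<open>y / c\<close>, since multiplication by \<open>c\<close> preserves distances.
  Cancelling the ball area \<open>K\<close>, which is neither 0 nor infinite, finishes.\<close>

lemma nn_integral_lborel_rotate:
  fixes f :: "complex \<Rightarrow> ennreal"
  assumes [measurable]: "f \<in> borel_measurable borel" and c: "cmod c = 1"
  shows "(\<integral>\<^sup>+ x. f (c * x) \<partial>lborel) = (\<integral>\<^sup>+ x. f x \<partial>lborel)"
proof -
  define K where "K = emeasure lborel (ball (0::complex) 1)"
  have ball: "emeasure lborel (ball a 1) = K" for a :: complex
    by (simp add: K_def emeasure_ball)
  have K: "K \<noteq> 0" "K \<noteq> \<infinity>"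
    by (simp_all add: K_def emeasure_ball unit_ball_vol_2)
  have c0: "c \<noteq> 0" using c by auto
  have shift: "(\<integral>\<^sup>+ x. f (c * x) \<partial>lborel) = (\<integral>\<^sup>+ x. f (c * x + y) \<partial>lborel)" for y
  proof -
    have "(\<integral>\<^sup>+ x. f (c * x) \<partial>lborel) = (\<integral>\<^sup>+ x. f (c * (y / c + x)) \<partial>lborel)"
      by (rule nn_integral_lborel_translate[where f="\<lambda>x. f (c * x)", symmetric]) measurable
    then show ?thesis using c0 by (simp add: algebra_simps)
  qed
  have norm_eq: "cmod (y - c * x) = cmod (y / c - x)" for x y
  proof -
    have "y - c * x = c * (y / c - x)" using c0 by (simp add: algebra_simps)
    then show ?thesis by (simp add: norm_mult c)
  qed
  define I :: "complex \<Rightarrow> ennreal" where "I = indicator (ball 0 1)"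
  have [measurable]: "I \<in> borel_measurable borel" by (simp add: I_def borel_measurable_indicator)
  have K_I: "(\<integral>\<^sup>+ y. I y \<partial>lborel) = K" by (simp add: I_def K_def)
  have "K * (\<integral>\<^sup>+ x. f (c * x) \<partial>lborel)
      = (\<integral>\<^sup>+ y. I y * (\<integral>\<^sup>+ x. f (c * x) \<partial>lborel) \<partial>lborel)"
    by (subst nn_integral_multc) (auto simp: K_I)
  also have "\<dots> = (\<integral>\<^sup>+ y. (\<integral>\<^sup>+ x. I y * f (c * x + y) \<partial>lborel) \<partial>lborel)"
    by (intro nn_integral_cong) (subst nn_integral_cmult; simp flip: shift)
  also have "\<dots> = (\<integral>\<^sup>+ x. (\<integral>\<^sup>+ y. I y * f (c * x + y) \<partial>lborel) \<partial>lborel)"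
    by (rule lborel_pair.Fubini') measurable
  also have "\<dots> = (\<integral>\<^sup>+ x. (\<integral>\<^sup>+ y. I (y - c * x) * f y \<partial>lborel) \<partial>lborel)"
  proof (rule nn_integral_cong)
    fix x :: complex
    show "(\<integral>\<^sup>+ y. I y * f (c * x + y) \<partial>lborel) =
          (\<integral>\<^sup>+ y. I (y - c * x) * f y \<partial>lborel)"
      by (subst nn_integral_lborel_translate
          [where f="\<lambda>y. I (y - c * x) * f y" and c="c * x", symmetric])
        simp_all
  qed
  also have "\<dots> = (\<integral>\<^sup>+ y. (\<integral>\<^sup>+ x. I (y - c * x) * f y \<partial>lborel) \<partial>lborel)"
    by (rule lborel_pair.Fubini') measurable
  also have "\<dots> = (\<integral>\<^sup>+ y. K * f y \<partial>lborel)"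
  proof (rule nn_integral_cong)
    fix y :: complex
    have "(\<integral>\<^sup>+ x. I (y - c * x) * f y \<partial>lborel)
        = (\<integral>\<^sup>+ x. indicator (ball (y / c) 1) x * f y \<partial>lborel)"
      by (intro nn_integral_cong) (simp add: I_def indicator_def dist_norm[of "y / c"] norm_eq)
    also have "\<dots> = K * f y"
      by (subst nn_integral_multc) (simp_all add: borel_measurable_indicator ball)
    finally show "(\<integral>\<^sup>+ x. I (y - c * x) * f y \<partial>lborel) = K * f y" .
  qed
  also have "\<dots> = K * (\<integral>\<^sup>+ y. f y \<partial>lborel)" by (simp add: nn_integral_cmult)
  finally show ?thesis using K by (simp add: ennreal_mult_cancel_left)
qed

lemma distr_lborel_rotate:
  assumes "cmod c = 1"
  shows "distr lborel borel ((*) c) = (lborel :: complex measure)"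
proof (rule measure_eqI)
  fix A assume "A \<in> sets (distr lborel borel ((*) c))"
  then have [measurable]: "A \<in> sets borel" by simp
  have "emeasure (distr lborel borel ((*) c)) A = (\<integral>\<^sup>+ x. indicator A (c * x) \<partial>lborel)"
    by (subst nn_integral_indicator[symmetric], simp, subst nn_integral_distr) simp_all
  also have "\<dots> = emeasure lborel A"
    by (subst nn_integral_lborel_rotate[where f="indicator A"]) (simp_all add: assms)
  finally show "emeasure (distr lborel borel ((*) c)) A = emeasure lborel A" .
qed simp

section \<open>Radial integration and Parseval's identity on discs\<close>

text \<open>A substitute for polar coordinates: the area of an annulus is linear in the squared
  radii, so \<open>|z|^2\<close> carries area to \<open>pi\<close> times length. It is enough to
  compare both measures on the half-lines \<open>{x<..}\<close>, where they are finite.\<close>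

lemma distr_cmod_power2_ball:
  assumes R: "0 < R"
  shows "distr (density lborel (indicator (ball 0 R))) borel (\<lambda>z::complex. (cmod z)\<^sup>2)
       = density lborel (\<lambda>u. ennreal pi * indicator {0..R\<^sup>2} u)" (is "?M = ?N")
proof (rule measure_eqI_lessThan)
  have M: "emeasure ?M {x<..} = ennreal (pi * max 0 (R\<^sup>2 - max 0 x))" for x
  proof -
    have "emeasure ?M {x<..} = emeasure (density lborel (indicator (ball 0 R)))
        ((\<lambda>z::complex. (cmod z)\<^sup>2) -` {x<..} \<inter> space (density lborel (indicator (ball 0 R))))"
      by (rule emeasure_distr) simp_all
    also have "\<dots> = emeasure lborel (ball 0 R \<inter> {z::complex. x < (cmod z)\<^sup>2})"
      by (subst emeasure_density)
        (auto simp: vimage_def indicator_inter_arith[symmetric] Int_def intro!: borel_measurable_indicator)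
    also have "\<dots> = ennreal (pi * max 0 (R\<^sup>2 - max 0 x))"
    proof (cases "x < 0")
      case True
      then have "ball 0 R \<inter> {z::complex. x < (cmod z)\<^sup>2} = ball 0 R"
        by (auto intro: less_le_trans)
      then show ?thesis using R True by (simp add: emeasure_ball unit_ball_vol_2)
    next
      case x: False
      show ?thesis
      proof (cases "x < R\<^sup>2")
        case True
        then have sq: "0 \<le> sqrt x" "sqrt x < R"
          using x R by (auto intro: real_less_lsqrt)
        have iff: "x < (cmod z)\<^sup>2 \<longleftrightarrow> \<not> cmod z \<le> sqrt x" for z
          using x by (metis linorder_not_less norm_ge_zero real_sqrt_less_iff real_sqrt_pow2_iff
             real_sqrt_abs abs_norm_cancel)
        have "ball 0 R \<inter> {z::complex. x < (cmod z)\<^sup>2} = ball 0 R - cball 0 (sqrt x)"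
          by (auto simp: iff)
        moreover have "emeasure lborel (ball (0::complex) R - cball 0 (sqrt x))
          = ennreal (pi * R\<^sup>2) - ennreal (pi * x)"
          using sq x by (subst emeasure_Diff) (auto simp: emeasure_ball[OF less_imp_le[OF R]] emeasure_cball unit_ball_vol_2)
        ultimately show ?thesis using x True R by (simp add: emeasure_ball unit_ball_vol_2 ennreal_minus algebra_simps)
      next
        case False
        have "\<not> x < (cmod z)\<^sup>2" if "cmod z < R" for z
          using False power_mono[of "cmod z" R 2] that by auto
        then have "ball 0 R \<inter> {z::complex. x < (cmod z)\<^sup>2} = {}" by auto
        then show ?thesis using False x by simp
      qed
    qed
    finally show ?thesis .
  qed
  have N: "emeasure ?N {x<..} = ennreal (pi * max 0 (R\<^sup>2 - max 0 x))" for x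
  proof -
    have "emeasure ?N {x<..} = (\<integral>\<^sup>+ u. ennreal pi * indicator ({0..R\<^sup>2} \<inter> {x<..}) u \<partial>lborel)"
      by (subst emeasure_density) (auto intro!: nn_integral_cong simp: indicator_def)
    also have "\<dots> = ennreal pi * emeasure lborel ({0..R\<^sup>2} \<inter> {x<..})"
      by (subst nn_integral_cmult) auto
    also have "emeasure lborel ({0..R\<^sup>2} \<inter> {x<..}) = ennreal (max 0 (R\<^sup>2 - max 0 x))"
    proof (cases "x < 0")
      case True
      then have "{0..R\<^sup>2} \<inter> {x<..} = {0..R\<^sup>2}" by auto
      then show ?thesis using True by simp
    next
      case False
      then have "{0..R\<^sup>2} \<inter> {x<..} = {x<..R\<^sup>2}" by auto
      then show ?thesis using False by (cases "x \<le> R\<^sup>2") auto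
    qed
    finally show ?thesis by (simp add: ennreal_mult)
  qed
  show "emeasure ?M {x<..} < \<infinity>" for x by (simp add: M)
  show "emeasure ?M {x<..} = emeasure ?N {x<..}" for x by (simp add: M N)
qed simp_all

lemma nn_integral_cmod_power_ball:
  assumes R: "0 < R"
  shows "(\<integral>\<^sup>+ z. ennreal (cmod z ^ (2 * n)) * indicator (ball 0 R) z \<partial>lborel)
       = ennreal (pi * R ^ (2 * n + 2) / (n + 1))"
proof -
  have "(\<integral>\<^sup>+ z. ennreal (cmod z ^ (2 * n)) * indicator (ball 0 R) z \<partial>lborel)
      = (\<integral>\<^sup>+ z. ennreal (((cmod z)\<^sup>2) ^ n) \<partial>(density lborel (indicator (ball 0 R))))"
    by (subst nn_integral_density)
      (auto simp: power_mult mult.commute power_commutes intro!: borel_measurable_indicator simp flip: power_mult)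
  also have "\<dots> = (\<integral>\<^sup>+ u. ennreal (u ^ n) \<partial>(distr (density lborel (indicator (ball 0 R))) borel (\<lambda>z::complex. (cmod z)\<^sup>2)))"
    by (subst nn_integral_distr) simp_all
  also have "\<dots> = (\<integral>\<^sup>+ u. ennreal pi * (ennreal (u ^ n) * indicator {0..R\<^sup>2} u) \<partial>lborel)"
    unfolding distr_cmod_power2_ball[OF R]
    by (subst nn_integral_density) (simp_all add: mult_ac)
  also have "\<dots> = ennreal pi * (\<integral>\<^sup>+ u. ennreal (u ^ n) * indicator {0..R\<^sup>2} u \<partial>lborel)"
    by (subst nn_integral_cmult) simp_all
  also have "(\<integral>\<^sup>+ u. ennreal (u ^ n) * indicator {0..R\<^sup>2} u \<partial>lborel)
      = ennreal ((R\<^sup>2) ^ Suc n / Suc n - 0 ^ Suc n / Suc n)"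
  proof (rule nn_integral_FTC_Icc[where F="\<lambda>x. x ^ Suc n / Suc n"])
    show "((\<lambda>u. u ^ Suc n / Suc n) has_real_derivative u ^ n) (at u)" for u :: real
      using DERIV_cdivide[OF DERIV_pow[of "Suc n" u], of "Suc n"] by simp
  qed auto
  also have "ennreal pi * \<dots> = ennreal (pi * ((R\<^sup>2) ^ Suc n / Suc n - 0 ^ Suc n / Suc n))"
    by (rule ennreal_mult'[symmetric]) simp
  finally show ?thesis
    by (simp add: power_mult mult.commute power_commutes power2_eq_square mult.assoc power_mult_distrib mult_2_right power_add)
qed

lemma borel_measurable_indicator_ball [measurable]:
  "indicator (ball (a::complex) r) \<in> borel_measurable borel"
  by (simp add: borel_measurable_indicator)

lemma integrable_ball_bounded:
  fixes f :: "complex \<Rightarrow> complex"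
  assumes "continuous_on UNIV f"
  shows "integrable lborel (\<lambda>z. indicator (ball 0 R) z *\<^sub>R f z)"
proof -
  have "compact (f ` cball 0 R)"
    by (intro compact_continuous_image continuous_on_subset[OF assms]) auto
  then obtain B where "\<And>z. z \<in> cball 0 R \<Longrightarrow> cmod (f z) \<le> B"
    by (fastforce dest!: compact_imp_bounded simp: bounded_iff)
  then show ?thesis
    using assms emeasure_lborel_ball_finite[of "0::complex" R]
    by (intro integrableI_bounded_set_indicator[where B=B])
       (auto intro!: borel_measurable_continuous_onI)
qed

lemma integral_monomials_orthogonal:
  assumes "n \<noteq> m"
  shows "(\<integral>z. indicator (ball 0 R) z *\<^sub>R (z ^ n * cnj (z ^ m)) \<partial>lborel) = 0"
proof -
  \<comment> \<open>The angle is chosen so that the rotation multiplies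
    \<open>z ^ n * cnj (z ^ m)\<close> by exactly -1. The integral over the disc then equals its own
    negative, and no integration over the angle is needed.\<close>
  define t where "t = pi / (real n - real m)"
  define c where "c = cis t"
  have c: "cmod c = 1" by (simp add: c_def)
  have c_eq: "c ^ n * cnj (c ^ m) = -1"
  proof -
    have "c ^ n * cnj (c ^ m) = cis ((real n - real m) * t)"
      by (simp add: c_def Complex.DeMoivre cis_cnj cis_mult left_diff_distrib)
    moreover have "(real n - real m) * t = pi" using assms by (simp add: t_def)
    ultimately show ?thesis by simp
  qed
  define g :: "complex \<Rightarrow> complex" where "g z = indicator (ball 0 R) z *\<^sub>R (z ^ n * cnj (z ^ m))" for z
  have g: "g \<in> borel_measurable borel"
    unfolding g_def using borel_measurable_integrable[OF integrable_ball_bounded[of "\<lambda>z. z ^ n * cnj (z ^ m)" R]]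
    by (simp add: continuous_intros)
  have "integral\<^sup>L lborel g = integral\<^sup>L (distr lborel borel ((*) c)) g"
    by (simp add: distr_lborel_rotate[OF c])
  also have "\<dots> = (\<integral>z. g (c * z) \<partial>lborel)"
    using g by (intro integral_distr) auto
  also have "\<dots> = (\<integral>z. - g z \<partial>lborel)"
  proof (intro Bochner_Integration.integral_cong refl)
    fix z
    have "(c * z) ^ n * cnj ((c * z) ^ m) = (c ^ n * cnj (c ^ m)) * (z ^ n * cnj (z ^ m))"
      by (simp add: power_mult_distrib)
    then have "g (c * z) = (c ^ n * cnj (c ^ m)) * g z"
      by (simp add: g_def indicator_def norm_mult c)
    then show "g (c * z) = - g z" by (simp only: c_eq) simp
  qed
  also have "\<dots> = - integral\<^sup>L lborel g" by simp
  finally have "integral\<^sup>L lborel g = 0" by simp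
  then show ?thesis unfolding g_def[abs_def] .
qed

lemma nn_integral_polynomial_ball:
  fixes c :: "nat \<Rightarrow> complex"
  assumes R: "0 < R"
  shows "(\<integral>\<^sup>+ z. ennreal ((cmod (\<Sum>n<N. c n * z ^ n))\<^sup>2) * indicator (ball 0 R) z \<partial>lborel)
    = ennreal (pi * (\<Sum>n<N. (cmod (c n))\<^sup>2 * R ^ (2 * n + 2) / (n + 1)))"
proof -
  let ?I = "\<lambda>f. \<integral>z. indicator (ball 0 R) z *\<^sub>R f z \<partial>lborel"
  have diag: "?I (\<lambda>z. z ^ n * cnj (z ^ n)) = of_real (pi * R ^ (2 * n + 2) / (n + 1))" for n
  proof -
    have eq: "indicator (ball 0 R) z *\<^sub>R (z ^ n * cnj (z ^ n))
        = complex_of_real (indicator (ball 0 R) z * cmod z ^ (2 * n))" for z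
    proof -
      have "z ^ n * cnj (z ^ n) = (complex_of_real ((cmod z)\<^sup>2)) ^ n"
        by (simp only: complex_norm_square power_mult_distrib complex_cnj_power)
      then show ?thesis by (simp add: indicator_def power_mult)
    qed
    have "?I (\<lambda>z. z ^ n * cnj (z ^ n))
       = complex_of_real (\<integral>z. indicator (ball 0 R) z * cmod z ^ (2 * n) \<partial>lborel)"
      unfolding eq by (rule integral_complex_of_real)
    also have "(\<integral>z. indicator (ball (0::complex) R) z * cmod z ^ (2 * n) \<partial>lborel) = pi * R ^ (2 * n + 2) / (n + 1)"
    proof (rule integral_eq_nn_integral[THEN trans])
      have "(\<integral>\<^sup>+ z. ennreal (indicator (ball (0::complex) R) z * cmod z ^ (2 * n)) \<partial>lborel)
        = (\<integral>\<^sup>+ z. ennreal (cmod z ^ (2 * n)) * indicator (ball 0 R) z \<partial>lborel)"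
        by (intro nn_integral_cong) (simp add: indicator_def)
      then show "enn2real (\<integral>\<^sup>+ z. ennreal (indicator (ball (0::complex) R) z * cmod z ^ (2 * n)) \<partial>lborel)
         = pi * R ^ (2 * n + 2) / (n + 1)"
        using R by (simp add: nn_integral_cmod_power_ball[OF R] del: power_Suc)
    qed auto
    finally show ?thesis .
  qed
  let ?p = "\<lambda>z. \<Sum>n<N. c n * z ^ n"
  have exp: "indicator (ball 0 R) z *\<^sub>R complex_of_real ((cmod (?p z))\<^sup>2)
     = (\<Sum>n<N. \<Sum>m<N. (c n * cnj (c m)) * (indicator (ball 0 R) z *\<^sub>R (z ^ n * cnj (z ^ m))))" for z
  proof -
    have "complex_of_real ((cmod (?p z))\<^sup>2) = (\<Sum>n<N. \<Sum>m<N. (c n * cnj (c m)) * (z ^ n * cnj (z ^ m)))"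
      unfolding complex_norm_square cnj_sum sum_product by (intro sum.cong refl) simp
    then show ?thesis by (simp add: scaleR_sum_right)
  qed
  have int: "integrable lborel (\<lambda>z. indicator (ball 0 R) z *\<^sub>R (z ^ n * cnj (z ^ m)))" for n m
    by (rule integrable_ball_bounded) (intro continuous_intros)
  have "complex_of_real (\<integral>z. indicator (ball 0 R) z * (cmod (?p z))\<^sup>2 \<partial>lborel)
      = ?I (\<lambda>z. complex_of_real ((cmod (?p z))\<^sup>2))"
    by (subst integral_complex_of_real[symmetric]) (simp add: scaleR_conv_of_real)
  also have "\<dots> = (\<Sum>n<N. \<Sum>m<N. (c n * cnj (c m)) * ?I (\<lambda>z. z ^ n * cnj (z ^ m)))"
    unfolding exp
    by (subst Bochner_Integration.integral_sum,
        intro Bochner_Integration.integrable_sum integrable_mult_right int,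
        intro sum.cong refl, subst Bochner_Integration.integral_sum,
        intro integrable_mult_right int, intro sum.cong refl integral_mult_right_zero)
  also have "\<dots> = (\<Sum>n<N. \<Sum>m<N. if m = n then (c n * cnj (c n)) * of_real (pi * R ^ (2 * n + 2) / (n + 1)) else 0)"
  proof (intro sum.cong refl)
    fix n m
    show "(c n * cnj (c m)) * ?I (\<lambda>z. z ^ n * cnj (z ^ m))
      = (if m = n then (c n * cnj (c n)) * of_real (pi * R ^ (2 * n + 2) / (n + 1)) else 0)"
      using diag[of n] integral_monomials_orthogonal[of n m R] by (cases "m = n") simp_all
  qed
  also have "\<dots> = (\<Sum>n<N. (c n * cnj (c n)) * of_real (pi * R ^ (2 * n + 2) / (n + 1)))"
    by simp
  also have "\<dots> = complex_of_real (pi * (\<Sum>n<N. (cmod (c n))\<^sup>2 * R ^ (2 * n + 2) / (n + 1)))"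
    unfolding sum_distrib_left of_real_sum
    by (intro sum.cong refl) (simp add: complex_norm_square[symmetric] flip: of_real_power)
  finally have real: "(\<integral>z. indicator (ball 0 R) z * (cmod (?p z))\<^sup>2 \<partial>lborel)
     = pi * (\<Sum>n<N. (cmod (c n))\<^sup>2 * R ^ (2 * n + 2) / (n + 1))"
    by (simp only: of_real_eq_iff)
  have "integrable lborel (\<lambda>z. indicator (ball 0 R) z *\<^sub>R complex_of_real ((cmod (?p z))\<^sup>2))"
    by (rule integrable_ball_bounded) (intro continuous_intros)
  then have "integrable lborel (\<lambda>z. complex_of_real (indicator (ball 0 R) z * (cmod (?p z))\<^sup>2))"
    by (simp add: scaleR_conv_of_real)
  then have "integrable lborel (\<lambda>z. indicator (ball 0 R) z * (cmod (?p z))\<^sup>2)"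
    by (simp only: complex_of_real_integrable_eq)
  then have "(\<integral>\<^sup>+ z. ennreal (indicator (ball 0 R) z * (cmod (?p z))\<^sup>2) \<partial>lborel)
     = ennreal (\<integral>z. indicator (ball 0 R) z * (cmod (?p z))\<^sup>2 \<partial>lborel)"
    by (rule nn_integral_eq_integral) auto
  moreover have "(\<integral>\<^sup>+ z. ennreal (indicator (ball 0 R) z * (cmod (?p z))\<^sup>2) \<partial>lborel)
    = (\<integral>\<^sup>+ z. ennreal ((cmod (?p z))\<^sup>2) * indicator (ball 0 R) z \<partial>lborel)"
    by (intro nn_integral_cong) (simp add: indicator_def)
  ultimately show ?thesis by (simp only: real)
qed

text \<open>Strictly inside the disc the partial sums are bounded uniformly by the absolutely
  convergent series at \<open>R\<close>, so dominated convergence passes from polynomials to the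
  power series.\<close>

lemma nn_integral_power_series_ball:
  fixes c :: "nat \<Rightarrow> complex"
  assumes R: "0 < R" "R < 1" and g: "\<And>z. cmod z < 1 \<Longrightarrow> (\<lambda>n. c n * z ^ n) sums g z"
  shows "(\<integral>\<^sup>+ z. ennreal ((cmod (g z))\<^sup>2) * indicator (ball 0 R) z \<partial>lborel)
    = (\<Sum>n. ennreal (pi * ((cmod (c n))\<^sup>2 * R ^ (2 * n + 2) / (n + 1))))"
proof -
  let ?p = "\<lambda>N z. \<Sum>n<N. c n * z ^ n"
  define u where "u N z = ennreal ((cmod (?p N z))\<^sup>2) * indicator (ball 0 R) z" for N z
  define u' where "u' z = ennreal ((cmod (g z))\<^sup>2) * indicator (ball 0 R) z" for z
  have u_meas [measurable]: "u N \<in> borel_measurable lborel" for N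
    unfolding u_def by (intro borel_measurable_times_ennreal borel_measurable_indicator) auto
  have lim: "(\<lambda>N. u N z) \<longlonglongrightarrow> u' z" for z
  proof (cases "z \<in> ball 0 R")
    case True
    then have "(\<lambda>N. ?p N z) \<longlonglongrightarrow> g z" using g[of z] R by (simp add: sums_def)
    then show ?thesis using True unfolding u_def u'_def
      by (auto intro!: tendsto_intros)
  qed (simp add: u_def u'_def)
  have [measurable]: "u' \<in> borel_measurable lborel"
    by (rule borel_measurable_LIMSEQ_order[OF lim u_meas])
  have "summable (\<lambda>n. cmod (c n) * R ^ n)"
  proof -
    \<comment> \<open>The midpoint of \<open>R\<close> and 1 still lies in the disc, and convergence
      at a point of larger modulus gives absolute convergence at \<open>R\<close>.\<close>
    have "summable (\<lambda>n. c n * of_real ((R + 1) / 2) ^ n)"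
      using R by (intro sums_summable[OF g]) (simp del: of_real_divide of_real_add)
    then have "summable (\<lambda>n. cmod (c n * of_real R ^ n))"
      using R by (intro powser_insidea) (simp_all only: norm_of_real, auto)
    then show ?thesis using R by (simp add: norm_mult norm_power)
  qed
  then have B: "(\<Sum>n<N. cmod (c n) * R ^ n) \<le> (\<Sum>n. cmod (c n) * R ^ n)" for N
    using R by (intro sum_le_suminf) auto
  define B where "B = (\<Sum>n. cmod (c n) * R ^ n)"
  have p_le: "cmod (?p N z) \<le> B" if "z \<in> ball 0 R" for N z
  proof -
    have "cmod (?p N z) \<le> (\<Sum>n<N. cmod (c n) * R ^ n)"
      using that by (intro order_trans[OF norm_sum] sum_mono)
        (auto simp: norm_mult norm_power intro!: mult_left_mono power_mono)
    then show ?thesis using B[of N] by (simp add: B_def)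
  qed
  have "(\<lambda>N. \<integral>\<^sup>+ z. u N z \<partial>lborel) \<longlonglongrightarrow> (\<integral>\<^sup>+ z. u' z \<partial>lborel)"
  proof (rule nn_integral_dominated_convergence[where w="\<lambda>z. ennreal (B\<^sup>2) * indicator (ball 0 R) z"])
    show "AE z in lborel. u N z \<le> ennreal (B\<^sup>2) * indicator (ball 0 R) z" for N
      using p_le by (intro AE_I2) (auto simp: u_def indicator_def intro!: ennreal_leI power_mono)
    have "(\<integral>\<^sup>+ z. ennreal (B\<^sup>2) * indicator (ball 0 R) (z::complex) \<partial>lborel)
        = ennreal (B\<^sup>2) * emeasure lborel (ball (0::complex) R)"
      by (simp add: nn_integral_cmult_indicator)
    also have "\<dots> < \<infinity>"
      using emeasure_lborel_ball_finite[of "0::complex" R] by (simp add: ennreal_mult_less_top)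
    finally show "(\<integral>\<^sup>+ z. ennreal (B\<^sup>2) * indicator (ball 0 R) (z::complex) \<partial>lborel) < \<infinity>" .
  qed (use lim in \<open>auto intro!: borel_measurable_times_ennreal borel_measurable_indicator\<close>)
  moreover have "(\<lambda>N. \<integral>\<^sup>+ z. u N z \<partial>lborel)
     = (\<lambda>N. \<Sum>n<N. ennreal (pi * ((cmod (c n))\<^sup>2 * R ^ (2 * n + 2) / (n + 1))))"
    unfolding u_def nn_integral_polynomial_ball[OF R(1)] using R
    by (subst sum_ennreal) (auto simp: sum_distrib_left simp del: power_Suc)
  ultimately have "(\<lambda>n. ennreal (pi * ((cmod (c n))\<^sup>2 * R ^ (2 * n + 2) / (n + 1)))) sums (\<integral>\<^sup>+ z. u' z \<partial>lborel)"
    by (simp add: sums_def)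
  then show ?thesis by (simp add: u'_def sums_iff)
qed

text \<open>No dominating function is available up to the boundary, and both sides may be infinite.
  Hence the disc is exhausted by radii increasing to 1, with monotone convergence for the integral
  and for the series.\<close>

lemma nn_integral_power_series_unit_ball:
  fixes c :: "nat \<Rightarrow> complex"
  assumes g: "\<And>z. cmod z < 1 \<Longrightarrow> (\<lambda>n. c n * z ^ n) sums g z"
    and meas: "(\<lambda>z. ennreal ((cmod (g z))\<^sup>2) * indicator (ball 0 1) z) \<in> borel_measurable lborel"
  shows "(\<integral>\<^sup>+ z. ennreal ((cmod (g z))\<^sup>2) * indicator (ball 0 1) z \<partial>lborel)
    = (\<Sum>n. ennreal (pi * ((cmod (c n))\<^sup>2 / (n + 1))))"
proof -
  define R :: "nat \<Rightarrow> real" where "R i = 1 - inverse (real (i + 2))" for i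
  have R: "0 < R i" "R i < 1" for i by (auto simp: R_def field_simps)
  have mono: "R i \<le> R j" if "i \<le> j" for i j
    using that by (auto simp: R_def intro!: le_imp_inverse_le)
  have R_lim: "R \<longlonglongrightarrow> 1"
  proof -
    have "(\<lambda>i. 1 - inverse (real (i + 2))) \<longlonglongrightarrow> 1 - 0"
      by (intro tendsto_intros LIMSEQ_ignore_initial_segment[OF lim_inverse_n])
    then show ?thesis by (simp add: R_def[abs_def])
  qed
  define v where "v i z = ennreal ((cmod (g z))\<^sup>2) * indicator (ball 0 (R i)) z" for i z
  have v_eq: "v i = (\<lambda>z. (ennreal ((cmod (g z))\<^sup>2) * indicator (ball 0 1) z) * indicator (ball 0 (R i)) z)" for i
    using R[of i] by (auto simp: v_def indicator_def fun_eq_iff)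
  have v_meas: "v i \<in> borel_measurable lborel" for i
    unfolding v_eq by (intro borel_measurable_times_ennreal meas borel_measurable_indicator) auto
  have "incseq v"
    using mono by (auto simp: incseq_def le_fun_def v_def indicator_def intro: less_le_trans)
  then have "(\<integral>\<^sup>+ z. (SUP i. v i z) \<partial>lborel) = (SUP i. integral\<^sup>N lborel (v i))"
    by (rule nn_integral_monotone_convergence_SUP[OF _ v_meas])
  moreover have "(SUP i. v i z) = ennreal ((cmod (g z))\<^sup>2) * indicator (ball 0 1) z" for z
  proof (cases "cmod z < 1")
    case True
    then obtain i where "cmod z < R i"
      using order_tendstoD(1)[OF R_lim, of "cmod z"] by (auto simp: eventually_sequentially)
    then show ?thesis using True
      by (intro antisym SUP_least SUP_upper2[of i]) (auto simp: v_def indicator_def)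
  next
    case False
    then have "v i z = 0" for i using R[of i] by (auto simp: v_def indicator_def)
    then show ?thesis using False by simp
  qed
  ultimately have lhs: "(\<integral>\<^sup>+ z. ennreal ((cmod (g z))\<^sup>2) * indicator (ball 0 1) z \<partial>lborel)
      = (SUP i. \<Sum>n. ennreal (pi * ((cmod (c n))\<^sup>2 * R i ^ (2 * n + 2) / (n + 1))))"
    using nn_integral_power_series_ball[OF R g, folded v_def] by (simp only:)
  also have "\<dots> = (\<Sum>n. SUP i. ennreal (pi * ((cmod (c n))\<^sup>2 * R i ^ (2 * n + 2) / (n + 1))))"
  proof (rule ennreal_suminf_SUP_eq[symmetric])
    show "incseq (\<lambda>i. ennreal (pi * ((cmod (c n))\<^sup>2 * R i ^ (2 * n + 2) / (n + 1))))" for n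
      using mono R by (intro incseq_SucI ennreal_leI mult_left_mono divide_right_mono power_mono)
        (auto simp: less_imp_le)
  qed
  also have "\<dots> = (\<Sum>n. ennreal (pi * ((cmod (c n))\<^sup>2 / (n + 1))))"
  proof (intro suminf_cong)
    fix n
    have "incseq (\<lambda>i. ennreal (pi * ((cmod (c n))\<^sup>2 * R i ^ (2 * n + 2) / (n + 1))))"
      using mono R by (intro incseq_SucI ennreal_leI mult_left_mono divide_right_mono power_mono)
        (auto simp: less_imp_le)
    then have "(\<lambda>i. ennreal (pi * ((cmod (c n))\<^sup>2 * R i ^ (2 * n + 2) / (n + 1))))
      \<longlonglongrightarrow> (SUP i. ennreal (pi * ((cmod (c n))\<^sup>2 * R i ^ (2 * n + 2) / (n + 1))))"
      by (rule LIMSEQ_SUP)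
    moreover have "(\<lambda>i. ennreal (pi * ((cmod (c n))\<^sup>2 * R i ^ (2 * n + 2) / (n + 1))))
      \<longlonglongrightarrow> ennreal (pi * ((cmod (c n))\<^sup>2 * 1 ^ (2 * n + 2) / (n + 1)))"
      by (intro tendsto_intros R_lim) auto
    ultimately show "(SUP i. ennreal (pi * ((cmod (c n))\<^sup>2 * R i ^ (2 * n + 2) / (n + 1))))
       = ennreal (pi * ((cmod (c n))\<^sup>2 / (n + 1)))"
      using LIMSEQ_unique by fastforce
  qed
  finally show ?thesis .
qed

subsection \<open>Hardy inequalities\<close>

text \<open>Concavity of the square root, with the derivative taken at the upper endpoint. It makes
  sums of increments divided by square roots telescope, as in the integral of
  \<open>dy / sqrt y\<close>.\<close>

lemma div_sqrt_le_sqrt_diff: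
  fixes x y :: real
  assumes "0 \<le> x" "x \<le> y"
  shows "(y - x) / sqrt y \<le> 2 * (sqrt y - sqrt x)"
proof (cases "y = 0")
  case False
  with assms have y: "sqrt y > 0" by simp
  have "y - x = (sqrt y - sqrt x) * (sqrt y + sqrt x)"
    using assms by (simp add: algebra_simps)
  also have "\<dots> \<le> (sqrt y - sqrt x) * (2 * sqrt y)"
    using assms by (intro mult_left_mono) auto
  finally show ?thesis using y by (simp add: field_simps)
qed (use assms in auto)

text \<open>The continuous model is the integral of \<open>1 / (x * sqrt (ln x))\<close>, which is
  \<open>2 * sqrt (ln x)\<close>. The remaining factor 2 in the constant 4 pays for replacing
  \<open>1 / (n + 2)\<close> by \<open>2 / (n + 3)\<close>, a multiple of a lower bound for the
  increment of the logarithm.\<close>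

lemma sum_inverse_sqrt_ln_le:
  "(\<Sum>k\<le>n. 1 / ((real k + 1) * sqrt (ln (real k + 2)))) \<le> 4 * sqrt (ln (real n + 2))"
proof (induction n)
  case 0
  have "1 / sqrt (ln 2) \<le> 4 * sqrt (ln 2)"
    using ln2_ge_two_thirds by (simp add: field_simps)
  then show ?case by simp
next
  case (Suc n)
  define x y where "x = ln (real n + 2)" and "y = ln (real n + 3)"
  have xy: "0 \<le> x" "x \<le> y" "0 < y" by (auto simp: x_def y_def)
  have "1 / (real n + 2) \<le> 2 * (1 / (real n + 3))" by (simp add: field_simps)
  also have "1 / (real n + 3) \<le> y - x"
    using ln_diff_le[of "real n + 2" "real n + 3"] by (simp add: x_def y_def field_simps)
  finally have "1 / (real n + 2) / sqrt y \<le> 2 * (y - x) / sqrt y"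
    using xy by (intro divide_right_mono) auto
  also have "\<dots> = 2 * ((y - x) / sqrt y)" by simp
  also have "\<dots> \<le> 2 * (2 * (sqrt y - sqrt x))"
    using div_sqrt_le_sqrt_diff[OF xy(1,2)] by (intro mult_left_mono) auto
  finally have "1 / ((real n + 2) * sqrt y) \<le> 4 * sqrt y - 4 * sqrt x" by simp
  moreover have "(\<Sum>k\<le>Suc n. 1 / ((real k + 1) * sqrt (ln (real k + 2))))
    = (\<Sum>k\<le>n. 1 / ((real k + 1) * sqrt (ln (real k + 2)))) + 1 / ((real n + 2) * sqrt y)"
    by (simp add: y_def add.commute)
  moreover have "sqrt (ln (real (Suc n) + 2)) = sqrt y" by (simp add: y_def add.commute)
  ultimately show ?case using Suc unfolding x_def by linarith
qed

text \<open>Muckenhoupt's argument with \<open>sqrt L\<close> as auxiliary weight. Cauchy-Schwarz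
  with weight \<open>g k * sqrt (L k)\<close> leaves a dual sum controlled by \<open>head\<close>;
  after exchanging the order of summation, the sum of \<open>w n * sqrt (L n)\<close> over
  \<open>n >= k\<close> must be at most \<open>2 * C / sqrt (L k)\<close>, which follows from
  \<open>tail\<close>. The two powers of \<open>sqrt (L k)\<close> then cancel.\<close>

lemma weighted_hardy:
  fixes w a L g :: "nat \<Rightarrow> real"
  assumes w: "\<And>n. 0 \<le> w n" and L: "\<And>n. 0 < L n" and g: "\<And>n. 0 < g n"
    and C: "0 \<le> C" and tail: "\<And>m N. (\<Sum>n=m..<N. w n) \<le> C / L m"
    and D: "0 \<le> D" and head: "\<And>n. (\<Sum>k\<le>n. 1 / (g k * sqrt (L k))) \<le> D * sqrt (L n)"
  shows "(\<Sum>n<M. w n * (\<Sum>k\<le>n. a k)\<^sup>2) \<le> 2 * D * C * (\<Sum>k<M. g k * (a k)\<^sup>2)"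
proof -
  have cs: "(\<Sum>k\<le>n. a k)\<^sup>2 \<le> (\<Sum>k\<le>n. g k * sqrt (L k) * (a k)\<^sup>2) * (D * sqrt (L n))" for n
  proof -
    have "(\<Sum>k\<le>n. a k)\<^sup>2 = (\<Sum>k\<le>n. (sqrt (g k * sqrt (L k)) * a k) * (1 / sqrt (g k * sqrt (L k))))\<^sup>2"
      using g L by (intro arg_cong[where f="\<lambda>x. x\<^sup>2"] sum.cong) (auto simp: less_imp_neq[symmetric])
    also have "\<dots> \<le> (\<Sum>k\<le>n. (sqrt (g k * sqrt (L k)) * a k)\<^sup>2) * (\<Sum>k\<le>n. (1 / sqrt (g k * sqrt (L k)))\<^sup>2)"
      by (rule Cauchy_Schwarz_ineq_sum)
    also have "\<dots> = (\<Sum>k\<le>n. g k * sqrt (L k) * (a k)\<^sup>2) * (\<Sum>k\<le>n. 1 / (g k * sqrt (L k)))"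
      using g L by (simp add: power_mult_distrib power_divide less_imp_le)
    also have "\<dots> \<le> (\<Sum>k\<le>n. g k * sqrt (L k) * (a k)\<^sup>2) * (D * sqrt (L n))"
      using g L by (intro mult_left_mono head sum_nonneg mult_nonneg_nonneg) (auto simp: less_imp_le)
    finally show ?thesis .
  qed
  define W where "W m = (\<Sum>n=m..<M. w n)" for m
  have W0: "0 \<le> W m" for m by (auto simp: W_def intro!: sum_nonneg w)
  have W_rec: "W m = w m + W (Suc m)" if "m < M" for m
    using that by (simp add: W_def sum.atLeast_Suc_lessThan)
  \<comment> \<open>The tail hypothesis is used in reverse, as \<open>L n <= C / W n\<close>. It
    turns the summand into an increment of \<open>W\<close> divided by \<open>sqrt (W n)\<close>,
    which is dominated by a telescoping difference. A vanishing \<open>W n\<close> is treated apart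
    because it appears as a divisor.\<close>
  have summand: "w n * sqrt (L n) \<le> 2 * sqrt C * (sqrt (W n) - sqrt (W (Suc n)))" if "n < M" for n
  proof (cases "W n = 0")
    case True
    then have "w n = 0" "W (Suc n) = 0" using W_rec[OF that] w[of n] W0[of "Suc n"] by linarith+
    then show ?thesis using True by simp
  next
    case False
    then have Wp: "W n > 0" using W0[of n] by simp
    have "L n * W n \<le> C" using tail[of n M] L[of n] by (simp add: W_def field_simps)
    then have "sqrt (L n) * sqrt (W n) \<le> sqrt C" by (simp flip: real_sqrt_mult)
    then have "sqrt (L n) \<le> sqrt C / sqrt (W n)" using Wp by (simp add: field_simps)
    then have "w n * sqrt (L n) \<le> w n * (sqrt C / sqrt (W n))" by (intro mult_left_mono w)
    also have "\<dots> = sqrt C * ((W n - W (Suc n)) / sqrt (W n))" using W_rec[OF that] by simp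
    also have "\<dots> \<le> sqrt C * (2 * (sqrt (W n) - sqrt (W (Suc n))))"
      using W_rec[OF that] w[of n] W0[of "Suc n"] C
      by (intro mult_left_mono div_sqrt_le_sqrt_diff) auto
    finally show ?thesis by (simp add: algebra_simps)
  qed
  have tailsum: "(\<Sum>n=k..<M. w n * sqrt (L n)) \<le> 2 * C / sqrt (L k)" if "k < M" for k
  proof -
    have "(\<Sum>n=k..<M. w n * sqrt (L n)) \<le> (\<Sum>n=k..<M. 2 * sqrt C * (sqrt (W n) - sqrt (W (Suc n))))"
      by (intro sum_mono summand) auto
    also have "\<dots> = 2 * sqrt C * (sqrt (W k) - sqrt (W M))"
      using sum_Suc_diff'[of k M "\<lambda>n. - sqrt (W n)"] that by (simp add: sum_distrib_left[symmetric])
    also have "\<dots> \<le> 2 * sqrt C * sqrt (C / L k)"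
      using tail[of k M] C by (intro mult_left_mono) (auto simp: W_def)
    also have "\<dots> = 2 * C / sqrt (L k)" using C by (simp add: real_sqrt_divide)
    finally show ?thesis .
  qed
  have "(\<Sum>n<M. w n * (\<Sum>k\<le>n. a k)\<^sup>2)
      \<le> (\<Sum>n<M. w n * ((\<Sum>k\<le>n. g k * sqrt (L k) * (a k)\<^sup>2) * (D * sqrt (L n))))"
    by (intro sum_mono mult_left_mono cs w)
  also have "\<dots> = D * (\<Sum>n<M. \<Sum>k | k < M \<and> k \<le> n. w n * sqrt (L n) * (g k * sqrt (L k) * (a k)\<^sup>2))"
    unfolding sum_distrib_left sum_distrib_right
    by (intro sum.cong) (auto simp: algebra_simps)
  also have "(\<Sum>n<M. \<Sum>k | k < M \<and> k \<le> n. w n * sqrt (L n) * (g k * sqrt (L k) * (a k)\<^sup>2))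
     = (\<Sum>k<M. \<Sum>n | n < M \<and> k \<le> n. w n * sqrt (L n) * (g k * sqrt (L k) * (a k)\<^sup>2))"
    using sum.swap_restrict[of "{..<M}" "{..<M}"
      "\<lambda>n k. w n * sqrt (L n) * (g k * sqrt (L k) * (a k)\<^sup>2)" "\<lambda>n k. k \<le> n"] by simp
  also have "\<dots> = (\<Sum>k<M. (\<Sum>n=k..<M. w n * sqrt (L n)) * (g k * sqrt (L k) * (a k)\<^sup>2))"
    unfolding sum_distrib_right by (intro sum.cong refl) auto
  also have "D * \<dots> \<le> D * (\<Sum>k<M. 2 * C / sqrt (L k) * (g k * sqrt (L k) * (a k)\<^sup>2))"
    using g L D by (intro mult_left_mono sum_mono mult_right_mono tailsum) (auto simp: less_imp_le)
  also have "\<dots> = 2 * D * C * (\<Sum>k<M. g k * (a k)\<^sup>2)"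
    unfolding sum_distrib_left
  proof (intro sum.cong refl)
    fix k
    have "sqrt (L k) \<noteq> 0" using L[of k] by simp
    then show "D * (2 * C / sqrt (L k) * (g k * sqrt (L k) * (a k)\<^sup>2)) = 2 * D * C * (g k * (a k)\<^sup>2)"
      by (simp add: field_simps)
  qed
  finally show ?thesis .
qed

lemma sum_inverse_squares_le: "(\<Sum>k=Suc n..<M. 1 / (real k + 1)\<^sup>2) \<le> 1 / (real n + 1)"
proof (cases "Suc n \<le> M")
  case True
  have "(\<Sum>k=Suc n..<M. 1 / (real k + 1)\<^sup>2) \<le> (\<Sum>k=Suc n..<M. (- 1 / real (Suc k)) - (- 1 / real k))"
  proof (intro sum_mono)
    fix k assume "k \<in> {Suc n..<M}"
    then have k: "0 < real k" by simp
    have "1 / (real k + 1)\<^sup>2 \<le> 1 / (real k * (real k + 1))"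
      using k by (intro divide_left_mono) (auto simp: power2_eq_square)
    also have "\<dots> = (- 1 / real (Suc k)) - (- 1 / real k)" using k by (simp add: field_simps)
    finally show "1 / (real k + 1)\<^sup>2 \<le> (- 1 / real (Suc k)) - (- 1 / real k)" .
  qed
  also have "\<dots> = 1 / (real n + 1) - 1 / real M"
    using sum_Suc_diff'[of "Suc n" M "\<lambda>k. - 1 / real k"] True by (simp add: add.commute)
  also have "\<dots> \<le> 1 / (real n + 1)" by simp
  finally show ?thesis .
qed simp

text \<open>In Cauchy-Schwarz the factor \<open>1 / (k + 1)\<close> is separated from
  \<open>a k\<close>; its squares sum to at most \<open>1 / (n + 1)\<close>, which cancels the outer
  weight. Exchanging the sums then counts each \<open>(a k)^2\<close> once for every
  \<open>n < k\<close>, that is \<open>k\<close> times.\<close>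

lemma dual_hardy:
  fixes a :: "nat \<Rightarrow> real"
  shows "(\<Sum>n<M. (real n + 1) * (\<Sum>k=Suc n..<M. a k / (real k + 1))\<^sup>2) \<le> (\<Sum>k<M. (real k + 1) * (a k)\<^sup>2)"
proof -
  have "(\<Sum>n<M. (real n + 1) * (\<Sum>k=Suc n..<M. a k / (real k + 1))\<^sup>2)
      \<le> (\<Sum>n<M. \<Sum>k=Suc n..<M. (a k)\<^sup>2)"
  proof (intro sum_mono)
    fix n
    have "(\<Sum>k=Suc n..<M. a k / (real k + 1))\<^sup>2 = (\<Sum>k=Suc n..<M. a k * (1 / (real k + 1)))\<^sup>2" by simp
    also have "\<dots> \<le> (\<Sum>k=Suc n..<M. (a k)\<^sup>2) * (\<Sum>k=Suc n..<M. (1 / (real k + 1))\<^sup>2)"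
      by (rule Cauchy_Schwarz_ineq_sum)
    also have "\<dots> \<le> (\<Sum>k=Suc n..<M. (a k)\<^sup>2) * (1 / (real n + 1))"
      using sum_inverse_squares_le[of n M] by (intro mult_left_mono sum_nonneg) (auto simp: power_divide)
    finally show "(real n + 1) * (\<Sum>k=Suc n..<M. a k / (real k + 1))\<^sup>2 \<le> (\<Sum>k=Suc n..<M. (a k)\<^sup>2)"
      by (simp add: field_simps)
  qed
  also have "\<dots> = (\<Sum>n<M. \<Sum>k | k < M \<and> n < k. (a k)\<^sup>2)"
    by (intro sum.cong refl) auto
  also have "\<dots> = (\<Sum>k<M. \<Sum>n | n < M \<and> n < k. (a k)\<^sup>2)"
    using sum.swap_restrict[of "{..<M}" "{..<M}" "\<lambda>n k. (a k)\<^sup>2" "\<lambda>n k. n < k"] by simp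
  also have "\<dots> = (\<Sum>k<M. real k * (a k)\<^sup>2)"
  proof (intro sum.cong refl)
    fix k assume "k \<in> {..<M}"
    then have "{n. n < M \<and> n < k} = {..<k}" by auto
    then show "(\<Sum>n | n < M \<and> n < k. (a k)\<^sup>2) = real k * (a k)\<^sup>2" by simp
  qed
  also have "\<dots> \<le> (\<Sum>k<M. (real k + 1) * (a k)\<^sup>2)"
    by (intro sum_mono mult_right_mono) auto
  finally show ?thesis .
qed

text \<open>The bound \<open>B\<close> is fixed before the vector and the size of the section, so
  that the section can later be enlarged to the whole matrix.\<close>

lemma hankel_square_sum_bound:
  fixes \<mu> :: "nat \<Rightarrow> real"
  assumes mu0: "\<And>n. 0 \<le> \<mu> n" and dec: "\<And>m n. m \<le> n \<Longrightarrow> \<mu> n \<le> \<mu> m"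
    and tail: "\<And>m N. (\<Sum>n=m..<N. (real n + 1) * (\<mu> n)\<^sup>2) \<le> C / ln (real m + 2)"
  shows "\<exists>B\<ge>0. \<forall>a M. (\<forall>k. 0 \<le> a k) \<longrightarrow>
      (\<Sum>n<M. (real n + 1) * (\<Sum>k<M. \<mu> (n + k) * a k)\<^sup>2) \<le> B * (\<Sum>k<M. (real k + 1) * (a k)\<^sup>2)"
proof -
  have C: "0 \<le> C" using tail[of 0 0] by (simp add: zero_le_divide_iff)
  \<comment> \<open>Monotone moments give \<open>(k + 1)^2 / 2 * (\<mu> k)^2\<close> as a lower
    bound for the weighted sum up to \<open>k\<close>, and the hypothesis at \<open>m = 0\<close>
    bounds that sum by \<open>C / ln 2\<close>. Hence
    \<open>\<mu> k <= sqrt E / (k + 1)\<close>.\<close>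
  define E where "E = 2 * C / ln 2"
  have E: "0 \<le> E" using C by (simp add: E_def)
  have mu_le: "\<mu> k \<le> sqrt E / (real k + 1)" for k
  proof -
    have "(real k + 1)\<^sup>2 / 2 \<le> (\<Sum>n=0..<Suc k. real n + 1)"
      by (induction k) (auto simp: power2_eq_square field_simps)
    then have "(real k + 1)\<^sup>2 / 2 * (\<mu> k)\<^sup>2 \<le> (\<Sum>n=0..<Suc k. real n + 1) * (\<mu> k)\<^sup>2"
      by (intro mult_right_mono) auto
    also have "\<dots> \<le> (\<Sum>n=0..<Suc k. (real n + 1) * (\<mu> n)\<^sup>2)"
      unfolding sum_distrib_right by (intro sum_mono mult_left_mono power_mono dec mu0) auto
    also have "\<dots> \<le> C / ln 2" using tail[where m=0 and N="Suc k"] by simp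
    finally have "((real k + 1) * \<mu> k)\<^sup>2 \<le> E" by (simp add: E_def power_mult_distrib mult.commute)
    then have "(real k + 1) * \<mu> k \<le> sqrt E" by (rule real_le_rsqrt)
    then show ?thesis by (simp add: field_simps)
  qed
  show ?thesis
  \<comment> \<open>The inequality \<open>(x + y)^2 <= 2 * x^2 + 2 * y^2\<close> doubles both parts:
    \<open>weighted_hardy\<close> with \<open>D = 4\<close> contributes
    \<open>2 * (2 * 4 * C)\<close>, and \<open>dual_hardy\<close> contributes
    \<open>2 * E\<close>.\<close>
  proof (intro exI[of _ "16 * C + 2 * E"] conjI allI impI)
    show "0 \<le> 16 * C + 2 * E" using C E by simp
    fix a :: "nat \<Rightarrow> real" and M
    assume "\<forall>k. 0 \<le> a k"
    then have a: "\<And>k. 0 \<le> a k" by simp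
    have split: "(real n + 1) * (\<Sum>k<M. \<mu> (n + k) * a k)\<^sup>2
      \<le> 2 * ((real n + 1) * (\<mu> n)\<^sup>2 * (\<Sum>k\<le>n. a k)\<^sup>2)
        + 2 * E * ((real n + 1) * (\<Sum>k=Suc n..<M. a k / (real k + 1))\<^sup>2)" if "n < M" for n
    proof -
      have M: "{..<M} = {..n} \<union> {Suc n..<M}" using that by auto
      have "(\<Sum>k<M. \<mu> (n + k) * a k) = (\<Sum>k\<le>n. \<mu> (n + k) * a k) + (\<Sum>k=Suc n..<M. \<mu> (n + k) * a k)"
        unfolding M by (rule sum.union_disjoint) auto
      also have "\<dots> \<le> (\<Sum>k\<le>n. \<mu> n * a k) + (\<Sum>k=Suc n..<M. sqrt E / (real k + 1) * a k)"
        using a by (intro add_mono sum_mono mult_right_mono dec order_trans[OF dec mu_le]) auto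
      also have "\<dots> = \<mu> n * (\<Sum>k\<le>n. a k) + sqrt E * (\<Sum>k=Suc n..<M. a k / (real k + 1))" (is "_ = ?x + ?y")
        by (simp add: sum_distrib_left)
      finally have "(\<Sum>k<M. \<mu> (n + k) * a k)\<^sup>2 \<le> (?x + ?y)\<^sup>2"
        using a mu0 by (intro power_mono sum_nonneg mult_nonneg_nonneg) auto
      also have "\<dots> \<le> 2 * ?x\<^sup>2 + 2 * ?y\<^sup>2"
        using zero_le_power2[of "?x - ?y"] unfolding power2_sum power2_diff by linarith
      finally have "(real n + 1) * (\<Sum>k<M. \<mu> (n + k) * a k)\<^sup>2 \<le> (real n + 1) * (2 * ?x\<^sup>2 + 2 * ?y\<^sup>2)"
        by (intro mult_left_mono) auto
      then show ?thesis using E by (simp add: power_mult_distrib algebra_simps)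
    qed
    have "(\<Sum>n<M. (real n + 1) * (\<Sum>k<M. \<mu> (n + k) * a k)\<^sup>2)
      \<le> 2 * (\<Sum>n<M. (real n + 1) * (\<mu> n)\<^sup>2 * (\<Sum>k\<le>n. a k)\<^sup>2)
        + 2 * E * (\<Sum>n<M. (real n + 1) * (\<Sum>k=Suc n..<M. a k / (real k + 1))\<^sup>2)"
      unfolding sum_distrib_left sum.distrib[symmetric] by (intro sum_mono split) auto
    also have "\<dots> \<le> 2 * (2 * 4 * C * (\<Sum>k<M. (real k + 1) * (a k)\<^sup>2))
        + 2 * E * (\<Sum>k<M. (real k + 1) * (a k)\<^sup>2)"
    proof (intro add_mono mult_left_mono dual_hardy weighted_hardy)
      show "(\<Sum>k\<le>n. 1 / ((real k + 1) * sqrt (ln (real k + 2)))) \<le> 4 * sqrt (ln (real n + 2))" for n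
        by (rule sum_inverse_sqrt_ln_le)
    qed (use C E tail in auto)
    also have "\<dots> = (16 * C + 2 * E) * (\<Sum>k<M. (real k + 1) * (a k)\<^sup>2)" by (simp add: algebra_simps)
    finally show "(\<Sum>n<M. (real n + 1) * (\<Sum>k<M. \<mu> (n + k) * a k)\<^sup>2)
      \<le> (16 * C + 2 * E) * (\<Sum>k<M. (real k + 1) * (a k)\<^sup>2)" .
  qed
qed

subsection \<open>The Dirichlet space\<close>

lemma taylor_coeff_sums:
  assumes "f holomorphic_on ball 0 1" "cmod z < 1"
  shows "(\<lambda>n. taylor_coeff f n * z ^ n) sums f z"
  using holomorphic_power_series[OF assms(1), of z] assms(2) by (simp add: taylor_coeff_def)

text \<open>Uniqueness of power series coefficients. It allows the Taylor coefficients of the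
  kernels and of the Hankel images to be read off from their series, without computing a
  derivative.\<close>

lemma power_series_unit_disc:
  assumes "\<And>z. cmod z < 1 \<Longrightarrow> (\<lambda>n. c n * z ^ n) sums f z"
  shows "f holomorphic_on ball 0 1" "taylor_coeff f n = c n"
proof -
  show "f holomorphic_on ball 0 1"
    by (rule power_series_holomorphic[where a=c]) (simp add: assms)
  have "1 \<le> fps_conv_radius (Abs_fps c)"
    unfolding fps_conv_radius_def
  proof (rule conv_radius_geI_ex)
    fix r :: real assume "0 < r" "ereal r < 1"
    then show "\<exists>z. norm z = r \<and> summable (\<lambda>n. fps_nth (Abs_fps c) n * z ^ n)"
      using assms[of "of_real r"] by (intro exI[of _ "of_real r"]) (auto simp: sums_iff)
  qed
  then have "0 < fps_conv_radius (Abs_fps c)" by (rule less_le_trans[rotated]) simp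
  moreover have "\<forall>\<^sub>F z in nhds 0. eval_fps (Abs_fps c) z = f z"
    unfolding eventually_nhds
    by (intro exI[of _ "ball 0 1"]) (auto simp: eval_fps_def sums_unique[OF assms, symmetric])
  ultimately have "f has_fps_expansion Abs_fps c" by (simp add: has_fps_expansion_def)
  from fps_nth_fps_expansion[OF this, of n] show "taylor_coeff f n = c n"
    by (simp add: taylor_coeff_def)
qed

lemma taylor_coeff_deriv: "taylor_coeff (deriv f) n = of_nat (n + 1) * taylor_coeff f (n + 1)"
  by (simp add: taylor_coeff_def funpow_Suc_right divide_simps del: funpow.simps of_nat_Suc)

text \<open>The derivative has coefficients \<open>(n + 1) * a_(n+1)\<close>, and Parseval divides
  their squares by \<open>n + 1\<close>. The series is taken in \<open>ennreal\<close>, so the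
  identity also covers functions of infinite norm.\<close>

lemma dirichlet_normsq_taylor:
  assumes f: "f holomorphic_on ball 0 1"
  shows "dirichlet_normsq f = ennreal ((cmod (taylor_coeff f 0))\<^sup>2)
    + (\<Sum>n. ennreal ((real n + 1) * (cmod (taylor_coeff f (n + 1)))\<^sup>2))"
proof -
  have f': "deriv f holomorphic_on ball 0 1" by (intro holomorphic_deriv f) auto
  have "continuous_on (ball 0 1) (\<lambda>z. (cmod (deriv f z))\<^sup>2)"
    by (intro continuous_intros holomorphic_on_imp_continuous_on f')
  then have "(\<lambda>z. indicator (ball 0 1) z *\<^sub>R (cmod (deriv f z))\<^sup>2) \<in> borel_measurable borel"
    by (intro borel_measurable_continuous_on_indicator) auto
  then have "(\<lambda>z. ennreal (indicator (ball 0 1) z *\<^sub>R (cmod (deriv f z))\<^sup>2)) \<in> borel_measurable lborel"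
    by (intro measurable_compose[OF _ measurable_ennreal]) simp
  moreover have "(\<lambda>z. ennreal (indicator (ball 0 1) z *\<^sub>R (cmod (deriv f z))\<^sup>2))
      = (\<lambda>z. ennreal ((cmod (deriv f z))\<^sup>2) * indicator (ball 0 1) z)"
    by (auto simp: indicator_def)
  ultimately have meas: "(\<lambda>z. ennreal ((cmod (deriv f z))\<^sup>2) * indicator (ball 0 1) z) \<in> borel_measurable lborel"
    by (simp only:)
  have coeff: "(cmod (taylor_coeff (deriv f) n))\<^sup>2 / (n + 1)
      = (real n + 1) * (cmod (taylor_coeff f (n + 1)))\<^sup>2" for n
    unfolding taylor_coeff_deriv norm_mult norm_of_nat
    by (simp add: power2_eq_square divide_simps)
  have "ennreal (1 / pi) * (\<integral>\<^sup>+ z. ennreal ((cmod (deriv f z))\<^sup>2) * indicator (ball 0 1) z \<partial>lborel)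
     = ennreal (1 / pi) * (\<Sum>n. ennreal (pi * ((real n + 1) * (cmod (taylor_coeff f (n + 1)))\<^sup>2)))"
    using nn_integral_power_series_unit_ball[OF taylor_coeff_sums[OF f'] meas] by (simp only: coeff)
  also have "\<dots> = (\<Sum>n. ennreal (1 / pi) * ennreal (pi * ((real n + 1) * (cmod (taylor_coeff f (n + 1)))\<^sup>2)))"
    by (rule ennreal_suminf_cmult[symmetric])
  also have "\<dots> = (\<Sum>n. ennreal ((real n + 1) * (cmod (taylor_coeff f (n + 1)))\<^sup>2))"
    by (intro suminf_cong, subst ennreal_mult[symmetric]) auto
  finally show ?thesis by (simp add: dirichlet_normsq_def taylor_coeff_def)
qed

text \<open>The weight \<open>n + 1\<close> puts the constant term and the others into one series
  and differs from the true weight by a factor of at most 2, since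
  \<open>k <= k + 1 <= 2 * k\<close> for \<open>k >= 1\<close>. The real witness \<open>r\<close>
  lets later estimates leave the extended reals.\<close>

lemma dirichlet_space_iff:
  "f \<in> dirichlet_space \<longleftrightarrow>
    f holomorphic_on ball 0 1 \<and> summable (\<lambda>n. (real n + 1) * (cmod (taylor_coeff f n))\<^sup>2)" (is "?l \<longleftrightarrow> ?h \<and> ?s")
  and dirichlet_norm_bounds:
  "f \<in> dirichlet_space \<Longrightarrow> \<exists>r\<ge>0. dirichlet_norm f = ennreal r \<and>
     r\<^sup>2 \<le> (\<Sum>n. (real n + 1) * (cmod (taylor_coeff f n))\<^sup>2) \<and>
     (\<Sum>n. (real n + 1) * (cmod (taylor_coeff f n))\<^sup>2) \<le> 2 * r\<^sup>2"
proof -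
  define a where "a n = (cmod (taylor_coeff f n))\<^sup>2" for n
  have a: "0 \<le> a n" for n by (simp add: a_def)
  have shift: "summable (\<lambda>n. (real n + 1) * a n) \<longleftrightarrow> summable (\<lambda>n. (real n + 1) * a (n + 1))"
  proof
    assume "summable (\<lambda>n. (real n + 1) * a n)"
    then have "summable (\<lambda>n. (real (Suc n) + 1) * a (Suc n))" by (subst summable_Suc_iff)
    then show "summable (\<lambda>n. (real n + 1) * a (n + 1))"
      by (rule summable_comparison_test') (auto simp: a intro!: mult_right_mono)
  next
    assume "summable (\<lambda>n. (real n + 1) * a (n + 1))"
    then have "summable (\<lambda>n. 2 * ((real n + 1) * a (n + 1)))" by (rule summable_mult)
    then have "summable (\<lambda>n. (real (Suc n) + 1) * a (Suc n))"
      by (rule summable_comparison_test') (use a in \<open>auto simp: algebra_simps\<close>)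
    then show "summable (\<lambda>n. (real n + 1) * a n)"
      using summable_Suc_iff[of "\<lambda>n. (real n + 1) * a n"] by blast
  qed
  have eq: "dirichlet_normsq f = ennreal (a 0) + (\<Sum>n. ennreal ((real n + 1) * a (n + 1)))" if ?h
    using dirichlet_normsq_taylor[OF that] by (simp add: a_def)
  have fin: "dirichlet_normsq f < \<infinity> \<longleftrightarrow> summable (\<lambda>n. (real n + 1) * a n)" if ?h
  proof -
    have "dirichlet_normsq f < \<infinity> \<longleftrightarrow> (\<Sum>n. ennreal ((real n + 1) * a (n + 1))) \<noteq> top"
      by (simp add: eq[OF that] less_top)
    also have "\<dots> \<longleftrightarrow> summable (\<lambda>n. (real n + 1) * a (n + 1))"
    proof
      assume "(\<Sum>n. ennreal ((real n + 1) * a (n + 1))) \<noteq> top"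
      then show "summable (\<lambda>n. (real n + 1) * a (n + 1))"
        by (intro summable_suminf_not_top) (auto simp: a)
    next
      assume "summable (\<lambda>n. (real n + 1) * a (n + 1))"
      then show "(\<Sum>n. ennreal ((real n + 1) * a (n + 1))) \<noteq> top"
        by (subst suminf_ennreal2) (auto simp: a)
    qed
    finally show ?thesis by (simp add: shift)
  qed
  show iff: "?l \<longleftrightarrow> ?h \<and> ?s"
    using fin by (auto simp: dirichlet_space_def a_def)
  show "\<exists>r\<ge>0. dirichlet_norm f = ennreal r \<and>
     r\<^sup>2 \<le> (\<Sum>n. (real n + 1) * (cmod (taylor_coeff f n))\<^sup>2) \<and>
     (\<Sum>n. (real n + 1) * (cmod (taylor_coeff f n))\<^sup>2) \<le> 2 * r\<^sup>2" if f: ?l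
  proof -
    have h: ?h and s: "summable (\<lambda>n. (real n + 1) * a n)" using f iff by (auto simp: a_def)
    have s1: "summable (\<lambda>n. (real n + 1) * a (n + 1))" using s shift by simp
    have s2: "summable (\<lambda>n. (real (Suc n) + 1) * a (Suc n))" using s by (subst summable_Suc_iff)
    define q where "q = a 0 + (\<Sum>n. (real n + 1) * a (n + 1))"
    have q0: "0 \<le> q" unfolding q_def by (intro add_nonneg_nonneg suminf_nonneg s1) (auto simp: a)
    have "dirichlet_normsq f = ennreal q"
      unfolding eq[OF h] q_def using s1 a
      by (subst suminf_ennreal2) (auto simp: ennreal_plus suminf_nonneg)
    then have norm: "dirichlet_norm f = ennreal (sqrt q)"
      using f q0 by (simp add: dirichlet_norm_def)
    have S: "(\<Sum>n. (real n + 1) * a n) = a 0 + (\<Sum>n. (real (Suc n) + 1) * a (Suc n))"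
      using suminf_split_head[OF s] by simp
    have "(\<Sum>n. (real n + 1) * a (n + 1)) \<le> (\<Sum>n. (real (Suc n) + 1) * a (Suc n))"
      using a by (intro suminf_le s1 s2) (auto intro!: mult_right_mono)
    then have 1: "q \<le> (\<Sum>n. (real n + 1) * a n)" by (simp add: q_def S)
    have "(\<Sum>n. (real (Suc n) + 1) * a (Suc n)) \<le> (\<Sum>n. 2 * ((real n + 1) * a (n + 1)))"
      using a by (intro suminf_le s2 summable_mult s1) (auto simp: algebra_simps)
    also have "\<dots> = 2 * (\<Sum>n. (real n + 1) * a (n + 1))" by (rule suminf_mult[OF s1])
    finally have 2: "(\<Sum>n. (real n + 1) * a n) \<le> 2 * q" using a[of 0] by (simp add: q_def S)
    show ?thesis
      using norm 1 2 q0 by (intro exI[of _ "sqrt q"]) (simp add: a_def)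
  qed
qed

text \<open>The terms of the weighted series tend to 0, so the coefficients are bounded and a
  geometric series dominates.\<close>

lemma summable_power_series_of_weighted_square_summable:
  fixes h :: "nat \<Rightarrow> complex"
  assumes "summable (\<lambda>n. (real n + 1) * (cmod (h n))\<^sup>2)" "cmod z < 1"
  shows "summable (\<lambda>n. h n * z ^ n)"
proof -
  have "(\<lambda>n. (real n + 1) * (cmod (h n))\<^sup>2) \<longlonglongrightarrow> 0" by (rule summable_LIMSEQ_zero) fact
  then have "Bseq (\<lambda>n. (real n + 1) * (cmod (h n))\<^sup>2)" by (rule convergentI[THEN convergent_imp_Bseq])
  then obtain K where K: "0 < K" "\<And>n. norm ((real n + 1) * (cmod (h n))\<^sup>2) \<le> K"
    by (auto elim: BseqE)
  have "cmod (h n) \<le> sqrt K" for n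
  proof (rule real_le_rsqrt)
    have "1 * (cmod (h n))\<^sup>2 \<le> (real n + 1) * (cmod (h n))\<^sup>2" by (intro mult_right_mono) auto
    then show "(cmod (h n))\<^sup>2 \<le> K" using K(2)[of n] by simp
  qed
  then show ?thesis
    by (intro summable_comparison_test'[OF summable_mult[OF summable_geometric[of "cmod z"], of "sqrt K"]])
       (auto simp: norm_mult norm_power assms(2) intro!: mult_right_mono)
qed

subsection \<open>The Hankel operator\<close>

lemma taylor_coeff_hankel_op:
  assumes "hankel_well_defined \<mu> f"
  shows "taylor_coeff (hankel_op \<mu> f) n = hankel_coeff \<mu> f n"
  using assms
  by (intro power_series_unit_disc(2)) (simp add: hankel_well_defined_def hankel_op_def summable_sums)

lemma hankel_op_in_dirichlet_space:
  assumes "\<And>n. summable (\<lambda>k. of_real (moment \<mu> (n + k)) * taylor_coeff f k)"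
    and "summable (\<lambda>n. (real n + 1) * (cmod (hankel_coeff \<mu> f n))\<^sup>2)"
  shows "hankel_well_defined \<mu> f" "hankel_op \<mu> f \<in> dirichlet_space"
proof -
  have sums: "(\<lambda>n. hankel_coeff \<mu> f n * z ^ n) sums hankel_op \<mu> f z" if "cmod z < 1" for z
    unfolding hankel_op_def
    by (intro summable_sums summable_power_series_of_weighted_square_summable assms(2) that)
  show wd: "hankel_well_defined \<mu> f"
    using assms(1) sums power_series_unit_disc(1)[OF sums]
    by (auto simp: hankel_well_defined_def sums_iff)
  then show "hankel_op \<mu> f \<in> dirichlet_space"
    using assms(2) by (simp add: dirichlet_space_iff taylor_coeff_hankel_op hankel_well_defined_def)
qed

text \<open>Passage from finite sections to the operator. The image of the absolute values,
  \<open>h\<close>, majorizes the Hankel coefficients, so its weighted square sum yields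
  well-definedness, membership in the space and the norm bound.\<close>

lemma hankel_bounded_of_tail_bound:
  assumes mu0: "\<And>n. 0 \<le> moment \<mu> n" and dec: "\<And>m n. m \<le> n \<Longrightarrow> moment \<mu> n \<le> moment \<mu> m"
    and tail: "\<And>m N. (\<Sum>n=m..<N. (real n + 1) * (moment \<mu> n)\<^sup>2) \<le> C / ln (real m + 2)"
  shows "hankel_bounded_on_dirichlet \<mu>"
proof -
  obtain B where B: "0 \<le> B" and bound: "\<And>a M. (\<And>k. 0 \<le> a k) \<Longrightarrow>
      (\<Sum>n<M. (real n + 1) * (\<Sum>k<M. moment \<mu> (n + k) * a k)\<^sup>2) \<le> B * (\<Sum>k<M. (real k + 1) * (a k)\<^sup>2)"
    using hankel_square_sum_bound[of "moment \<mu>", OF mu0 dec tail] by blast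
  have main: "hankel_well_defined \<mu> f \<and>
      dirichlet_norm (hankel_op \<mu> f) \<le> ennreal (sqrt (2 * B) + 1) * dirichlet_norm f"
    if f: "f \<in> dirichlet_space" for f
  proof -
    define a where "a k = cmod (taylor_coeff f k)" for k
    have a: "0 \<le> a k" for k by (simp add: a_def)
    have s: "summable (\<lambda>k. (real k + 1) * (a k)\<^sup>2)" using f by (simp add: dirichlet_space_iff a_def)
    define S where "S = (\<Sum>k. (real k + 1) * (a k)\<^sup>2)"
    have S0: "0 \<le> S" unfolding S_def by (intro suminf_nonneg s) auto
    have fin: "(\<Sum>n<M. (real n + 1) * (\<Sum>k<M. moment \<mu> (n + k) * a k)\<^sup>2) \<le> B * S" for M
      using bound[of a M] mult_left_mono[OF sum_le_suminf[OF s, of "{..<M}"] B] a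
      by (force simp: S_def)
    have part: "(\<Sum>k<M. moment \<mu> (n + k) * a k) \<le> sqrt (B * S)" for n M
    proof -
      \<comment> \<open>The section is enlarged so that row \<open>n\<close> is one of its rows and
        can be compared with the whole square sum.\<close>
      let ?M = "max M (Suc n)"
      have "(\<Sum>k<M. moment \<mu> (n + k) * a k) \<le> (\<Sum>k<?M. moment \<mu> (n + k) * a k)"
        using a mu0 by (intro sum_mono2) auto
      also have "\<dots> \<le> sqrt (B * S)"
      proof (rule real_le_rsqrt)
        have "1 * (\<Sum>k<?M. moment \<mu> (n + k) * a k)\<^sup>2 \<le> (real n + 1) * (\<Sum>k<?M. moment \<mu> (n + k) * a k)\<^sup>2"
          by (intro mult_right_mono) auto
        also have "\<dots> \<le> (\<Sum>n<?M. (real n + 1) * (\<Sum>k<?M. moment \<mu> (n + k) * a k)\<^sup>2)"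
          by (rule member_le_sum) auto
        also note fin
        finally show "(\<Sum>k<?M. moment \<mu> (n + k) * a k)\<^sup>2 \<le> B * S" by simp
      qed
      finally show ?thesis .
    qed
    have row: "summable (\<lambda>k. moment \<mu> (n + k) * a k)" for n
      using a mu0 part by (intro summableI_nonneg_bounded) auto
    define h where "h n = (\<Sum>k. moment \<mu> (n + k) * a k)" for n
    \<comment> \<open>The number \<open>N\<close> of rows stays fixed while the columns
      \<open>M\<close> grow. Once \<open>M >= N\<close>, the rectangle lies inside a square section,
      to which \<open>fin\<close> applies.\<close>
    have h: "(\<Sum>n<N. (real n + 1) * (h n)\<^sup>2) \<le> B * S" for N
    proof (rule LIMSEQ_le_const2)
      show "(\<lambda>M. \<Sum>n<N. (real n + 1) * (\<Sum>k<M. moment \<mu> (n + k) * a k)\<^sup>2)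
          \<longlonglongrightarrow> (\<Sum>n<N. (real n + 1) * (h n)\<^sup>2)"
        unfolding h_def by (intro tendsto_intros summable_LIMSEQ row)
      have "(\<Sum>n<N. (real n + 1) * (\<Sum>k<M. moment \<mu> (n + k) * a k)\<^sup>2) \<le> B * S" if "N \<le> M" for M
      proof (rule order_trans[OF sum_mono2 fin[of M]])
      qed (use that in auto)
      then show "\<exists>N'. \<forall>M\<ge>N'. (\<Sum>n<N. (real n + 1) * (\<Sum>k<M. moment \<mu> (n + k) * a k)\<^sup>2) \<le> B * S"
        by blast
    qed
    have row': "summable (\<lambda>k. cmod (of_real (moment \<mu> (n + k)) * taylor_coeff f k))" for n
      using row[of n] mu0 by (simp add: norm_mult a_def)
    have hc: "cmod (hankel_coeff \<mu> f n) \<le> h n" for n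
      using summable_norm[OF row'[of n]] mu0 by (simp add: hankel_coeff_def h_def norm_mult a_def)
    have hs: "(\<Sum>n<N. (real n + 1) * (cmod (hankel_coeff \<mu> f n))\<^sup>2) \<le> B * S" for N
      by (rule order_trans[OF sum_mono h[of N]]) (auto intro!: mult_left_mono power_mono hc)
    have sm: "summable (\<lambda>n. (real n + 1) * (cmod (hankel_coeff \<mu> f n))\<^sup>2)"
      using hs by (intro summableI_nonneg_bounded) auto
    have wd: "hankel_well_defined \<mu> f" and D: "hankel_op \<mu> f \<in> dirichlet_space"
      using hankel_op_in_dirichlet_space[OF summable_norm_cancel[OF row'] sm] by auto
    obtain r where r: "0 \<le> r" "dirichlet_norm f = ennreal r" "S \<le> 2 * r\<^sup>2"
      using dirichlet_norm_bounds[OF f] by (auto simp: S_def a_def)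
    obtain r' where r': "0 \<le> r'" "dirichlet_norm (hankel_op \<mu> f) = ennreal r'"
        "r'\<^sup>2 \<le> (\<Sum>n. (real n + 1) * (cmod (hankel_coeff \<mu> f n))\<^sup>2)"
      using dirichlet_norm_bounds[OF D] by (auto simp: taylor_coeff_hankel_op[OF wd])
    have "r'\<^sup>2 \<le> B * S" using r'(3) suminf_le_const[OF sm hs] by linarith
    also have "\<dots> \<le> B * (2 * r\<^sup>2)" by (intro mult_left_mono r B)
    finally have "r'\<^sup>2 \<le> (sqrt (2 * B) * r)\<^sup>2" using B by (simp add: power_mult_distrib)
    then have "r' \<le> sqrt (2 * B) * r" by (rule power2_le_imp_le) (use r B in simp)
    also have "\<dots> \<le> (sqrt (2 * B) + 1) * r" using r by (intro mult_right_mono) auto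
    finally have "ennreal r' \<le> ennreal (sqrt (2 * B) + 1) * ennreal r"
      using r B by (subst ennreal_mult[symmetric]) (auto intro: ennreal_leI)
    then show ?thesis using wd r r' by simp
  qed
  \<comment> \<open>The factor 2 under the root is the loss in comparing \<open>S\<close> with the
    squared norm. The summand 1 secures a strictly positive constant even when
    \<open>B = 0\<close>.\<close>
  have "0 < sqrt (2 * B) + 1" using B by (simp add: add_nonneg_pos)
  then show ?thesis
    unfolding hankel_bounded_on_dirichlet_def using main by blast
qed

subsection \<open>Reproducing kernels\<close>

text \<open>The real form of the square root of \<open>K_t(t)\<close>, the normalizing factor of the
  kernel at \<open>t\<close>.\<close>

definition kernel_norm :: "real \<Rightarrow> real" where
  "kernel_norm t = sqrt (1 - ln (1 - t\<^sup>2))"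

definition kernel_coeff :: "real \<Rightarrow> nat \<Rightarrow> real" where
  "kernel_coeff t n = (if n = 0 then 1 else t ^ n / n) / kernel_norm t"

lemma
  assumes "0 \<le> t" "t < 1"
  shows kernel_norm_ge_1: "1 \<le> kernel_norm t"
    and kernel_norm_power2: "(kernel_norm t)\<^sup>2 = 1 - ln (1 - t\<^sup>2)"
proof -
  have "t\<^sup>2 < 1" using assms by (simp add: power_less_one_iff abs_square_less_1)
  then have "ln (1 - t\<^sup>2) \<le> 0" by simp
  then show "1 \<le> kernel_norm t" "(kernel_norm t)\<^sup>2 = 1 - ln (1 - t\<^sup>2)"
    by (simp_all add: kernel_norm_def)
qed

lemma log_series_with_constant:
  fixes x :: complex
  assumes "cmod x < 1"
  shows "(\<lambda>n. if n = 0 then 1 else x ^ n / of_nat n) sums (1 + Ln (1 / (1 - x)))"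
proof -
  have "0 < Re (1 - x)" using abs_Re_le_cmod[of x] assms by simp
  then have "1 - x \<notin> \<real>\<^sub>\<le>\<^sub>0" by (auto simp: complex_nonpos_Reals_iff)
  then have L: "Ln (1 / (1 - x)) = - Ln (1 - x)" by (simp add: Ln_inverse flip: inverse_eq_divide)
  \<comment> \<open>Division by zero yields 0, so the term at \<open>n = 0\<close> vanishes and the
    constant 1 of the kernel can be added in that slot.\<close>
  have log: "(\<lambda>n. x ^ n / of_nat n) sums - Ln (1 - x)"
    using sums_minus[OF Ln_series'[of "- x"]] assms by simp
  have "(\<lambda>n. (if n = 0 then 1 else 0) + x ^ n / of_nat n) sums (1 + Ln (1 / (1 - x)))"
    unfolding L by (intro sums_add sums_single log)
  moreover have "(\<lambda>n. (if n = 0 then 1 else 0) + x ^ n / of_nat n) = (\<lambda>n. if n = 0 then 1 else x ^ n / of_nat n)"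
    by auto
  ultimately show ?thesis by simp
qed

lemma normalized_dirichlet_kernel_sums:
  assumes t: "0 \<le> t" "t < 1" and z: "cmod z < 1"
  shows "(\<lambda>n. of_real (kernel_coeff t n) * z ^ n) sums normalized_dirichlet_kernel (of_real t) z"
proof -
  have t2: "t\<^sup>2 < 1" using t by (simp add: power_less_one_iff abs_square_less_1)
  have "dirichlet_kernel (of_real t) (of_real t) = 1 + Ln (of_real (1 / (1 - t\<^sup>2)))"
    by (simp add: dirichlet_kernel_def power2_eq_square)
  also have "\<dots> = of_real ((kernel_norm t)\<^sup>2)"
    unfolding kernel_norm_power2[OF t] using t2 by (subst Ln_of_real) (auto simp: ln_div)
  finally have "csqrt (dirichlet_kernel (of_real t) (of_real t)) = of_real (kernel_norm t)"
    using kernel_norm_ge_1[OF t] by (simp add: csqrt_of_real_nonneg del: of_real_power)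
  moreover have "cmod (z * of_real t) < 1"
  proof -
    have "cmod z * t \<le> cmod z * 1" using t by (intro mult_left_mono) auto
    then show ?thesis using z t by (simp add: norm_mult)
  qed
  then have "(\<lambda>n. (if n = 0 then 1 else (z * of_real t) ^ n / of_nat n) / of_real (kernel_norm t))
     sums ((1 + Ln (1 / (1 - z * of_real t))) / of_real (kernel_norm t))"
    by (intro sums_divide log_series_with_constant)
  moreover have "(\<lambda>n. (if n = 0 then 1 else (z * of_real t) ^ n / of_nat n) / of_real (kernel_norm t))
     = (\<lambda>n. complex_of_real (kernel_coeff t n) * z ^ n)"
    by (auto simp: kernel_coeff_def fun_eq_iff power_mult_distrib)
  ultimately show ?thesis by (simp add: normalized_dirichlet_kernel_def dirichlet_kernel_def)
qed

lemma taylor_coeff_normalized_dirichlet_kernel: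
  assumes "0 \<le> t" "t < 1"
  shows "taylor_coeff (normalized_dirichlet_kernel (of_real t)) n = of_real (kernel_coeff t n)"
  by (rule power_series_unit_disc(2)) (rule normalized_dirichlet_kernel_sums[OF assms])

text \<open>For \<open>n >= 1\<close>, one factor \<open>n\<close> cancels in
  \<open>(n + 1) * (t ^ n / n)^2 <= 2 * (t^2) ^ n / n\<close>, leaving the logarithmic series at
  \<open>t^2\<close>, whose sum with the constant is \<open>(kernel_norm t)^2\<close>. The true norm
  is 1; the weight \<open>n + 1\<close> costs the factor \<open>sqrt 2\<close>, which is harmless
  since only uniformity in \<open>t\<close> matters.\<close>

lemma normalized_dirichlet_kernel_norm:
  assumes t: "0 \<le> t" "t < 1"
  shows "normalized_dirichlet_kernel (of_real t) \<in> dirichlet_space"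
    and "dirichlet_norm (normalized_dirichlet_kernel (of_real t)) \<le> ennreal (sqrt 2)"
proof -
  let ?k = "normalized_dirichlet_kernel (of_real t)" and ?K = "kernel_norm t"
  have t2: "t\<^sup>2 < 1" using t by (simp add: power_less_one_iff abs_square_less_1)
  have K: "1 \<le> ?K" by (rule kernel_norm_ge_1[OF t])
  have "(\<lambda>n. if n = 0 then 1 else complex_of_real (t\<^sup>2) ^ n / of_nat n) sums (1 + Ln (1 / (1 - complex_of_real (t\<^sup>2))))"
    using t2 by (intro log_series_with_constant) (simp del: of_real_power)
  also have "(1 + Ln (1 / (1 - complex_of_real (t\<^sup>2)))) = 1 + Ln (of_real (1 / (1 - t\<^sup>2)))" by simp
  also have "\<dots> = of_real (?K\<^sup>2)"
    unfolding kernel_norm_power2[OF t] using t2 by (subst Ln_of_real) (auto simp: ln_div)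
  also have "(\<lambda>n. if n = 0 then 1 else complex_of_real (t\<^sup>2) ^ n / of_nat n)
      = (\<lambda>n. complex_of_real (if n = 0 then 1 else (t\<^sup>2) ^ n / of_nat n))"
    by auto
  finally have "(\<lambda>n. if n = 0 then 1 else (t\<^sup>2) ^ n / n) sums ?K\<^sup>2"
    unfolding sums_of_real_iff .
  then have "(\<lambda>n. 2 / ?K\<^sup>2 * (if n = 0 then 1 else (t\<^sup>2) ^ n / n)) sums (2 / ?K\<^sup>2 * ?K\<^sup>2)"
    by (rule sums_mult)
  then have sums: "(\<lambda>n. 2 / ?K\<^sup>2 * (if n = 0 then 1 else (t\<^sup>2) ^ n / n)) sums 2" using K by simp
  have le: "(real n + 1) * (kernel_coeff t n)\<^sup>2 \<le> 2 / ?K\<^sup>2 * (if n = 0 then 1 else (t\<^sup>2) ^ n / n)" for n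
  proof (cases "n = 0")
    case False
    then have "(real n + 1) * (t ^ n / n)\<^sup>2 \<le> (2 * real n) * (t ^ n / n)\<^sup>2"
      by (intro mult_right_mono) auto
    also have "\<dots> = 2 * ((t\<^sup>2) ^ n / n)"
      using False by (simp add: power2_eq_square power_mult_distrib)
    finally have "(real n + 1) * (t ^ n / n)\<^sup>2 / ?K\<^sup>2 \<le> 2 * ((t\<^sup>2) ^ n / n) / ?K\<^sup>2"
      by (rule divide_right_mono) simp
    then show ?thesis using False by (simp add: kernel_coeff_def power_divide power_mult_distrib mult.commute)
  qed (simp add: kernel_coeff_def power_divide divide_right_mono)
  have sm: "summable (\<lambda>n. (real n + 1) * (cmod (taylor_coeff ?k n))\<^sup>2)"
    unfolding taylor_coeff_normalized_dirichlet_kernel[OF t]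
    by (rule summable_comparison_test'[OF sums_summable[OF sums]]) (use le in simp)
  then show D: "?k \<in> dirichlet_space"
    using power_series_unit_disc(1)[OF normalized_dirichlet_kernel_sums[OF t]]
    by (simp add: dirichlet_space_iff)
  have "(\<Sum>n. (real n + 1) * (cmod (taylor_coeff ?k n))\<^sup>2) \<le> (\<Sum>n. 2 / ?K\<^sup>2 * (if n = 0 then 1 else (t\<^sup>2) ^ n / n))"
    using le by (intro suminf_le sm sums_summable[OF sums])
      (simp add: taylor_coeff_normalized_dirichlet_kernel[OF t])
  also have "\<dots> = 2" using sums by (simp add: sums_iff)
  finally show "dirichlet_norm ?k \<le> ennreal (sqrt 2)"
    using dirichlet_norm_bounds[OF D] by (auto intro!: ennreal_leI real_le_rsqrt)
qed

text \<open>With \<open>l = ln (m + 2)\<close>, three facts combine: \<open>t ^ k >= 1 / 3\<close>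
  for \<open>k <= m\<close>, the harmonic sum is at least \<open>l\<close>, and the squared
  normalizing factor is at most \<open>3 * l\<close>. The sum is thus at least
  \<open>l / (3 * K)\<close>, and squaring gives \<open>l^2 / (9 * 3 * l) = l / 27\<close>.\<close>

lemma kernel_coeff_sum_lower_bound:
  fixes m :: nat
  defines "t \<equiv> (real m + 1) / (real m + 2)"
  shows "ln (real m + 2) / 27 \<le> (\<Sum>k\<le>m. kernel_coeff t k)\<^sup>2"
proof -
  have t: "0 < t" "t < 1" by (auto simp: t_def)
  define l where "l = ln (real m + 2)"
  have "ln 2 \<le> l" by (simp add: l_def)
  then have l: "2 / 3 \<le> l" using ln2_ge_two_thirds by linarith
  define K where "K = kernel_norm t"
  have K1: "1 \<le> K" unfolding K_def using t by (intro kernel_norm_ge_1) auto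
  have K2: "K\<^sup>2 \<le> 3 * l"
  proof -
    have "t\<^sup>2 \<le> t" using t by (simp add: power2_eq_square mult_left_le)
    then have "ln (1 - t) \<le> ln (1 - t\<^sup>2)" using t by (intro ln_mono) auto
    moreover have "1 - t = 1 / (real m + 2)" by (simp add: t_def field_simps)
    then have "ln (1 - t) = - l" by (simp add: l_def ln_div)
    moreover have "K\<^sup>2 = 1 - ln (1 - t\<^sup>2)"
      unfolding K_def using t by (intro kernel_norm_power2) auto
    ultimately show ?thesis using l by linarith
  qed
  have tm: "1 / 3 \<le> t ^ m"
  proof -
    \<comment> \<open>The reciprocal power stays below \<open>exp 1\<close>, hence below 3.\<close>
    have "(1 / t) ^ m = (1 + 1 / (real m + 1)) ^ m" by (simp add: t_def field_simps)
    also have "\<dots> \<le> exp (1 / (real m + 1)) ^ m" by (intro power_mono exp_ge_add_one_self) auto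
    also have "\<dots> = exp (real m / (real m + 1))" by (simp flip: exp_of_nat_mult)
    also have "\<dots> \<le> exp 1" by simp
    also have "\<dots> \<le> 3" by (rule exp_le)
    finally show ?thesis using t by (simp add: field_simps power_one_over)
  qed
  have harm: "l \<le> (\<Sum>k\<le>m. if k = 0 then 1 else 1 / real k)"
  proof -
    have "l \<le> harm (m + 1)" using ln_le_harm[of "m + 1"] by (simp add: l_def add.commute)
    also have "\<dots> = (\<Sum>k=1..m. 1 / real k) + 1 / (real m + 1)"
      by (simp add: harm_def inverse_eq_divide add.commute)
    \<comment> \<open>The last harmonic term is traded for the constant coefficient of the kernel,
      which is 1 before normalization.\<close>
    also have "\<dots> \<le> (\<Sum>k=1..m. 1 / real k) + 1" by simp
    also have "\<dots> = (\<Sum>k\<le>m. if k = 0 then 1 else 1 / real k)"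
    proof -
      have "{..m} = insert 0 {1..m}" by auto
      then show ?thesis by simp
    qed
    finally show ?thesis .
  qed
  have "l / (3 * K) \<le> (\<Sum>k\<le>m. if k = 0 then 1 else 1 / real k) / (3 * K)"
    using harm K1 by (intro divide_right_mono) auto
  also have "\<dots> = (\<Sum>k\<le>m. (1 / 3) * (if k = 0 then 1 else 1 / real k) / K)"
    by (simp add: sum_divide_distrib)
  also have "\<dots> \<le> (\<Sum>k\<le>m. kernel_coeff t k)"
  proof (intro sum_mono)
    fix k assume "k \<in> {..m}"
    then have "t ^ m \<le> t ^ k" using t by (intro power_decreasing) auto
    then have "1 / 3 \<le> t ^ k" using tm by linarith
    then have "1 / 3 * (if k = 0 then 1 else 1 / real k) \<le> (if k = 0 then 1 else t ^ k / real k)"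
      by (simp add: divide_right_mono)
    then show "1 / 3 * (if k = 0 then 1 else 1 / real k) / K \<le> kernel_coeff t k"
      unfolding kernel_coeff_def K_def[symmetric] using K1 by (intro divide_right_mono) auto
  qed
  finally have "(l / (3 * K))\<^sup>2 \<le> (\<Sum>k\<le>m. kernel_coeff t k)\<^sup>2"
    using l K1 by (intro power_mono) auto
  moreover have "l / 27 \<le> (l / (3 * K))\<^sup>2"
  proof -
    have "l / 27 = l\<^sup>2 / (9 * (3 * l))" using l by (simp add: power2_eq_square)
    also have "\<dots> \<le> l\<^sup>2 / (9 * K\<^sup>2)" using K1 K2 l by (intro divide_left_mono) auto
    also have "\<dots> = (l / (3 * K))\<^sup>2" by (simp add: power_divide power_mult_distrib)
    finally show ?thesis .
  qed
  ultimately show ?thesis unfolding l_def by linarith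
qed

section \<open>From the kernel test to the tail condition on the moments\<close>

text \<open>The image of \<open>k_t\<close> has nonnegative coefficients, so cutting each row after
  \<open>k = m\<close> only lowers them. The constant 54 is 27 from the kernel sum times 2 from the
  comparison of the norms.\<close>

lemma even_moment_tail_bound:
  assumes mu0: "\<And>n. 0 \<le> moment \<mu> n" and dec: "\<And>m n. m \<le> n \<Longrightarrow> moment \<mu> n \<le> moment \<mu> m"
    and wd: "\<And>t. 0 \<le> t \<Longrightarrow> t < 1 \<Longrightarrow> hankel_well_defined \<mu> (normalized_dirichlet_kernel (of_real t))"
    and b: "0 \<le> b" "\<And>t. 0 \<le> t \<Longrightarrow> t < 1 \<Longrightarrow>
      dirichlet_norm (hankel_op \<mu> (normalized_dirichlet_kernel (of_real t))) \<le> ennreal b"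
  shows "(\<Sum>n=m..<N. (real n + 1) * (moment \<mu> (2 * n))\<^sup>2) \<le> 54 * b\<^sup>2 / ln (real m + 2)"
proof -
  define t where "t = (real m + 1) / (real m + 2)"
  have t: "0 \<le> t" "t < 1" by (auto simp: t_def)
  let ?k = "normalized_dirichlet_kernel (of_real t)"
  define l where "l = ln (real m + 2)"
  have l: "0 < l" by (simp add: l_def)
  note wdt = wd[OF t]
  \<comment> \<open>Functions outside the space have infinite \<open>dirichlet_norm\<close>, so a
    finite value already gives membership.\<close>
  have "dirichlet_norm (hankel_op \<mu> ?k) < \<infinity>" using b(2)[OF t] by (simp add: le_less_trans)
  then have D: "hankel_op \<mu> ?k \<in> dirichlet_space" by (auto simp: dirichlet_norm_def split: if_splits)
  obtain r where r: "0 \<le> r" "ennreal r \<le> ennreal b"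
      "(\<Sum>n. (real n + 1) * (cmod (hankel_coeff \<mu> ?k n))\<^sup>2) \<le> 2 * r\<^sup>2"
    using dirichlet_norm_bounds[OF D] b(2)[OF t] by (auto simp: taylor_coeff_hankel_op[OF wdt])
  have sm: "summable (\<lambda>n. (real n + 1) * (cmod (hankel_coeff \<mu> ?k n))\<^sup>2)"
    using D by (simp add: dirichlet_space_iff taylor_coeff_hankel_op[OF wdt])
  have "r \<le> b" using r b by simp
  then have "r\<^sup>2 \<le> b\<^sup>2" using r by (intro power_mono) auto
  have kc: "0 \<le> kernel_coeff t k" for k
    using kernel_norm_ge_1[OF t] t by (simp add: kernel_coeff_def)
  have coeff: "l / 27 * (moment \<mu> (2 * n))\<^sup>2 \<le> (cmod (hankel_coeff \<mu> ?k n))\<^sup>2" if "m \<le> n" for n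
  proof -
    let ?x = "\<lambda>k. moment \<mu> (n + k) * kernel_coeff t k"
    have "summable (\<lambda>k. complex_of_real (?x k))"
      using wdt by (simp add: hankel_well_defined_def taylor_coeff_normalized_dirichlet_kernel[OF t])
    then have s: "summable ?x" unfolding summable_of_real_iff .
    have "hankel_coeff \<mu> ?k n = (\<Sum>k. complex_of_real (?x k))"
      by (simp add: hankel_coeff_def taylor_coeff_normalized_dirichlet_kernel[OF t])
    also have "\<dots> = of_real (suminf ?x)" using s by (rule suminf_of_real[symmetric])
    finally have eq: "hankel_coeff \<mu> ?k n = of_real (suminf ?x)" .
    \<comment> \<open>Here \<open>k <= m <= n\<close>, so \<open>n + k <= 2 * n\<close> and the
      moments decrease.\<close>
    have "moment \<mu> (2 * n) * (\<Sum>k\<le>m. kernel_coeff t k) \<le> (\<Sum>k\<le>m. ?x k)"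
      unfolding sum_distrib_left using that by (intro sum_mono mult_right_mono dec kc) auto
    also have "\<dots> \<le> suminf ?x" using s mu0 kc by (intro sum_le_suminf) auto
    finally have "(moment \<mu> (2 * n) * (\<Sum>k\<le>m. kernel_coeff t k))\<^sup>2 \<le> (suminf ?x)\<^sup>2"
      using mu0 kc by (intro power_mono mult_nonneg_nonneg sum_nonneg) auto
    moreover have "(moment \<mu> (2 * n))\<^sup>2 * (l / 27) \<le> (moment \<mu> (2 * n))\<^sup>2 * (\<Sum>k\<le>m. kernel_coeff t k)\<^sup>2"
      unfolding l_def t_def by (intro mult_left_mono kernel_coeff_sum_lower_bound) auto
    ultimately show ?thesis by (simp add: eq power_mult_distrib mult.commute)
  qed
  have "l / 27 * (\<Sum>n=m..<N. (real n + 1) * (moment \<mu> (2 * n))\<^sup>2)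
      = (\<Sum>n=m..<N. (real n + 1) * (l / 27 * (moment \<mu> (2 * n))\<^sup>2))"
    by (simp add: sum_distrib_left mult_ac)
  also have "\<dots> \<le> (\<Sum>n=m..<N. (real n + 1) * (cmod (hankel_coeff \<mu> ?k n))\<^sup>2)"
    by (intro sum_mono mult_left_mono coeff) auto
  also have "\<dots> \<le> (\<Sum>n. (real n + 1) * (cmod (hankel_coeff \<mu> ?k n))\<^sup>2)"
    by (intro sum_le_suminf sm) auto
  also have "\<dots> \<le> 2 * b\<^sup>2" using r \<open>r\<^sup>2 \<le> b\<^sup>2\<close> by linarith
  finally show ?thesis using l by (simp add: l_def field_simps)
qed

text \<open>Indices \<open>2 * j\<close> and \<open>2 * j + 1\<close> are paired: their weights add
  up to \<open>4 * j + 3\<close>, giving the factor 4. Halving the starting index costs another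
  factor 2 in the logarithm, because \<open>M + 2 <= 2 * m + 3 <= (m + 2)^2\<close> for
  \<open>m = M div 2\<close>.\<close>

lemma tail_bound_of_even_tail_bound:
  fixes \<mu> :: "nat \<Rightarrow> real"
  assumes mu0: "\<And>n. 0 \<le> \<mu> n" and dec: "\<And>m n. m \<le> n \<Longrightarrow> \<mu> n \<le> \<mu> m"
    and even: "\<And>m N. (\<Sum>n=m..<N. (real n + 1) * (\<mu> (2 * n))\<^sup>2) \<le> C / ln (real m + 2)"
  shows "(\<Sum>n=M..<N. (real n + 1) * (\<mu> n)\<^sup>2) \<le> 8 * C / ln (real M + 2)"
proof -
  let ?m = "M div 2"
  have C: "0 \<le> C" using even[of 0 0] by (simp add: zero_le_divide_iff)
  have "(\<Sum>n=M..<N. (real n + 1) * (\<mu> n)\<^sup>2) \<le> (\<Sum>n=2 * ?m..Suc (2 * N). (real n + 1) * (\<mu> n)\<^sup>2)"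
    by (intro sum_mono2) auto
  also have "\<dots> = (\<Sum>j=?m..N. (real (2 * j) + 1) * (\<mu> (2 * j))\<^sup>2 + (real (Suc (2 * j)) + 1) * (\<mu> (Suc (2 * j)))\<^sup>2)"
    by (rule sum.in_pairs)
  also have "\<dots> \<le> (\<Sum>j=?m..N. 4 * ((real j + 1) * (\<mu> (2 * j))\<^sup>2))"
  proof (intro sum_mono)
    fix j
    have "(\<mu> (Suc (2 * j)))\<^sup>2 \<le> (\<mu> (2 * j))\<^sup>2" by (intro power_mono dec mu0) auto
    moreover have "(real (2 * j) + 1) * x + (real (Suc (2 * j)) + 1) * y \<le> 4 * ((real j + 1) * x)"
      if "y \<le> x" "0 \<le> x" for x y :: real
    proof -
      have "(real (Suc (2 * j)) + 1) * y \<le> (real (Suc (2 * j)) + 1) * x"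
        using that by (intro mult_left_mono) auto
      then show ?thesis using that by (simp add: algebra_simps)
    qed
    ultimately show "(real (2 * j) + 1) * (\<mu> (2 * j))\<^sup>2 + (real (Suc (2 * j)) + 1) * (\<mu> (Suc (2 * j)))\<^sup>2
       \<le> 4 * ((real j + 1) * (\<mu> (2 * j))\<^sup>2)"
      by simp
  qed
  also have "\<dots> = 4 * (\<Sum>j=?m..<Suc N. (real j + 1) * (\<mu> (2 * j))\<^sup>2)"
    by (simp add: sum_distrib_left atLeastLessThanSuc_atLeastAtMost)
  also have "\<dots> \<le> 4 * (C / ln (real ?m + 2))" by (intro mult_left_mono even) auto
  also have "\<dots> \<le> 4 * (C / (ln (real M + 2) / 2))"
  proof -
    have "M \<le> 2 * ?m + 1" by simp
    then have half: "real M \<le> 2 * real ?m + 1" by linarith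
    have "2 * x + 3 \<le> (x + 2)\<^sup>2" if "0 \<le> x" for x :: real
      using that zero_le_power2[of x] unfolding power2_sum by (simp add: add_increasing)
    from this[of "real ?m"] have "2 * real ?m + 3 \<le> (real ?m + 2)\<^sup>2" by simp
    with half have "real M + 2 \<le> (real ?m + 2) ^ 2" by linarith
    then have "ln (real M + 2) \<le> ln ((real ?m + 2) ^ 2)" by (intro ln_mono) auto
    also have "\<dots> = 2 * ln (real ?m + 2)" by (subst ln_realpow) auto
    finally have "ln (real M + 2) / 2 \<le> ln (real ?m + 2)" by simp
    then show ?thesis using C by (intro mult_left_mono divide_left_mono) auto
  qed
  finally show ?thesis by simp
qed

text \<open>Bounds on all finite sums carry summability with them, which makes the right-hand form
  convenient for estimates. The weights \<open>n\<close> and \<open>n + 1\<close> are comparable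
  except at \<open>n = 0\<close>.\<close>

lemma tail_bound_iff:
  fixes \<mu> :: "nat \<Rightarrow> real"
  shows "(summable (\<lambda>n. real n * (\<mu> n)\<^sup>2) \<and>
      (\<exists>C. \<forall>m. (\<Sum>n. real (m + n) * (\<mu> (m + n))\<^sup>2) \<le> C / ln (real m + 2)))
    \<longleftrightarrow> (\<exists>C. \<forall>m N. (\<Sum>n=m..<N. (real n + 1) * (\<mu> n)\<^sup>2) \<le> C / ln (real m + 2))" (is "?l \<longleftrightarrow> ?r")
proof
  assume ?l
  then obtain C where s: "summable (\<lambda>n. real n * (\<mu> n)\<^sup>2)"
    and C: "\<And>m. (\<Sum>n. real (m + n) * (\<mu> (m + n))\<^sup>2) \<le> C / ln (real m + 2)" by blast
  have "(\<Sum>n=m..<N. (real n + 1) * (\<mu> n)\<^sup>2) \<le> ((\<mu> 0)\<^sup>2 * ln 2 + 2 * C) / ln (real m + 2)" for m N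
  proof -
    have "(\<Sum>n=m..<N. (real n + 1) * (\<mu> n)\<^sup>2)
        \<le> (\<Sum>n=m..<N. (if n = 0 then (\<mu> 0)\<^sup>2 else 0) + 2 * (real n * (\<mu> n)\<^sup>2))"
    proof (intro sum_mono)
      fix n
      show "(real n + 1) * (\<mu> n)\<^sup>2 \<le> (if n = 0 then (\<mu> 0)\<^sup>2 else 0) + 2 * (real n * (\<mu> n)\<^sup>2)"
        by (cases n) (auto simp: algebra_simps)
    qed
    also have "\<dots> = (\<Sum>n=m..<N. if n = 0 then (\<mu> 0)\<^sup>2 else 0) + 2 * (\<Sum>n=m..<N. real n * (\<mu> n)\<^sup>2)"
      by (simp add: sum.distrib sum_distrib_left)
    \<comment> \<open>The index 0 occurs only for \<open>m = 0\<close>, where the denominator is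
      \<open>ln 2\<close> and the right-hand side is \<open>(\<mu> 0)^2\<close>.\<close>
    also have "(\<Sum>n=m..<N. if n = 0 then (\<mu> 0)\<^sup>2 else 0) \<le> (\<mu> 0)\<^sup>2 * ln 2 / ln (real m + 2)"
      by (cases m) auto
    also have "(\<Sum>n=m..<N. real n * (\<mu> n)\<^sup>2) = (\<Sum>n<N - m. real (m + n) * (\<mu> (m + n))\<^sup>2)"
      by (rule sum.reindex_bij_witness[of _ "\<lambda>n. m + n" "\<lambda>n. n - m"]) auto
    also have "\<dots> \<le> (\<Sum>n. real (m + n) * (\<mu> (m + n))\<^sup>2)"
      using summable_ignore_initial_segment[OF s, of m]
      by (intro sum_le_suminf) (auto simp: add.commute)
    also note C
    finally show ?thesis by (simp add: add_divide_distrib)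
  qed
  then show ?r by blast
next
  assume ?r
  then obtain C where C: "\<And>m N. (\<Sum>n=m..<N. (real n + 1) * (\<mu> n)\<^sup>2) \<le> C / ln (real m + 2)" by blast
  have fin: "(\<Sum>n<N. real (m + n) * (\<mu> (m + n))\<^sup>2) \<le> C / ln (real m + 2)" for m N
  proof -
    have "(\<Sum>n<N. real (m + n) * (\<mu> (m + n))\<^sup>2) = (\<Sum>n=m..<m + N. real n * (\<mu> n)\<^sup>2)"
      by (rule sum.reindex_bij_witness[of _ "\<lambda>n. n - m" "\<lambda>n. m + n"]) auto
    also have "\<dots> \<le> (\<Sum>n=m..<m + N. (real n + 1) * (\<mu> n)\<^sup>2)"
      by (intro sum_mono mult_right_mono) auto
    also note C
    finally show ?thesis .
  qed
  have sm: "summable (\<lambda>n. real (m + n) * (\<mu> (m + n))\<^sup>2)" for m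
    by (rule summableI_nonneg_bounded[where x="C / ln (real m + 2)"]) (use fin in auto)
  show ?l using sm[of 0] suminf_le_const[OF sm fin] by auto
qed

section \<open>The moments of the measure and the equivalence\<close>

text \<open>This is how the measure enters the estimates: powers of \<open>t\<close> in
  \<open>[0,1)\<close> are nonnegative, bounded by 1 and decreasing in the exponent, and finiteness
  of the measure makes them integrable.\<close>

lemma moment_nonneg_antimono:
  assumes "sets \<mu> = sets (restrict_space borel {0..<1::real})" "finite_measure \<mu>"
  shows "0 \<le> moment \<mu> n" and "m \<le> n \<Longrightarrow> moment \<mu> n \<le> moment \<mu> m"
proof -
  have "space \<mu> = {0..<1}" using sets_eq_imp_space_eq[OF assms(1)] by (simp add: space_restrict_space)
  then have t: "0 \<le> t" "t < 1" if "t \<in> space \<mu>" for t using that by auto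
  have "(\<lambda>t::real. t ^ n) \<in> borel_measurable (restrict_space borel {0..<1})" for n
    by (intro measurable_restrict_space1) simp
  then have "(\<lambda>t. t ^ n) \<in> borel_measurable \<mu>" for n
    by (subst measurable_cong_sets[OF assms(1) refl])
  then have int: "integrable \<mu> (\<lambda>t. t ^ n)" for n
    using t by (intro finite_measure.integrable_const_bound[OF assms(2), where B=1] AE_I2)
      (auto intro!: power_le_one simp: less_imp_le)
  show "0 \<le> moment \<mu> n" unfolding moment_def using t by (intro integral_nonneg_AE AE_I2) auto
  show "moment \<mu> n \<le> moment \<mu> m" if "m \<le> n"
    unfolding moment_def using t that by (intro integral_mono int power_decreasing) (auto simp: less_imp_le)
qed

theorem theorem1p2:
  fixes \<mu> :: "real measure"
  assumes "sets \<mu> = sets (restrict_space borel {0..<1})"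
    and "finite_measure \<mu>"
  defines "cond_i \<equiv> hankel_bounded_on_dirichlet \<mu>"
    and "cond_ii \<equiv>
      (\<forall>t\<in>{0..<1::real}. hankel_well_defined \<mu> (normalized_dirichlet_kernel (of_real t))) \<and>
      (SUP t\<in>{0..<1::real}.
         dirichlet_norm (hankel_op \<mu> (normalized_dirichlet_kernel (of_real t)))) < \<infinity>"
    and "cond_iii \<equiv>
      summable (\<lambda>n. real n * (moment \<mu> n)\<^sup>2) \<and>
      (\<exists>C::real. \<forall>m::nat.
         (\<Sum>n. real (m + n) * (moment \<mu> (m + n))\<^sup>2) \<le> C / ln (real m + 2))"
  shows "(cond_i \<longleftrightarrow> cond_ii) \<and> (cond_ii \<longleftrightarrow> cond_iii)"
proof -
  note mu0 = moment_nonneg_antimono(1)[OF assms(1,2)]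
    and dec = moment_nonneg_antimono(2)[OF assms(1,2)]
  \<comment> \<open>The kernels are themselves elements of the space of norm at most
    \<open>sqrt 2\<close>, so the operator bound applies to them uniformly in
    \<open>t\<close>.\<close>
  have "cond_ii" if "cond_i"
  proof -
    obtain C where wd: "\<And>f. f \<in> dirichlet_space \<Longrightarrow> hankel_well_defined \<mu> f"
      and C: "\<And>f. f \<in> dirichlet_space \<Longrightarrow> dirichlet_norm (hankel_op \<mu> f) \<le> ennreal C * dirichlet_norm f"
      using \<open>cond_i\<close> unfolding cond_i_def hankel_bounded_on_dirichlet_def by blast
    have "dirichlet_norm (hankel_op \<mu> (normalized_dirichlet_kernel (of_real t))) \<le> ennreal C * ennreal (sqrt 2)"
      if "t \<in> {0..<1}" for t
      using that normalized_dirichlet_kernel_norm[of t]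
      by (intro order_trans[OF C] mult_left_mono) auto
    then have "(SUP t\<in>{0..<1::real}. dirichlet_norm (hankel_op \<mu> (normalized_dirichlet_kernel (of_real t))))
        \<le> ennreal C * ennreal (sqrt 2)"
      by (intro SUP_least)
    also have "\<dots> < \<infinity>" by (simp add: ennreal_mult_less_top)
    finally show ?thesis
      unfolding cond_ii_def using wd normalized_dirichlet_kernel_norm(1) by auto
  qed
  moreover have "cond_iii" if "cond_ii"
  proof -
    define s where "s = (SUP t\<in>{0..<1::real}.
      dirichlet_norm (hankel_op \<mu> (normalized_dirichlet_kernel (of_real t))))"
    have "s < \<infinity>" using that by (simp add: cond_ii_def s_def)
    then have s: "s = ennreal (enn2real s)" by simp
    have "dirichlet_norm (hankel_op \<mu> (normalized_dirichlet_kernel (of_real t))) \<le> ennreal (enn2real s)"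
      if "0 \<le> t" "t < 1" for t
      using that by (subst s[symmetric]) (auto simp: s_def intro!: SUP_upper)
    moreover have "hankel_well_defined \<mu> (normalized_dirichlet_kernel (of_real t))" if "0 \<le> t" "t < 1" for t
      using that \<open>cond_ii\<close> by (simp add: cond_ii_def)
    ultimately have "(\<Sum>n=m..<N. (real n + 1) * (moment \<mu> (2 * n))\<^sup>2) \<le> 54 * (enn2real s)\<^sup>2 / ln (real m + 2)" for m N
      using mu0 dec by (intro even_moment_tail_bound) auto
    then have "\<exists>C. \<forall>m N. (\<Sum>n=m..<N. (real n + 1) * (moment \<mu> n)\<^sup>2) \<le> C / ln (real m + 2)"
      using tail_bound_of_even_tail_bound[of "moment \<mu>" "54 * (enn2real s)\<^sup>2"] mu0 dec by blast
    then show ?thesis unfolding cond_iii_def tail_bound_iff .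
  qed
  moreover have "cond_i" if "cond_iii"
  proof -
    from that obtain C where
      "\<And>m N. (\<Sum>n=m..<N. (real n + 1) * (moment \<mu> n)\<^sup>2) \<le> C / ln (real m + 2)"
      unfolding cond_iii_def tail_bound_iff by blast
    then show ?thesis unfolding cond_i_def
      using mu0 dec by (intro hankel_bounded_of_tail_bound) auto
  qed
  ultimately show ?thesis by blast
qed

end
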